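(* Let $q=p^m$ with $p$ prime such that $4\mid\frac{q-1}{p-1}$, $q\ge5$ and $q\ne9$, and put $n=\frac{q-1}{4}$. Then $\Gamma(4,q)$ is connected and integral, with spectrum given as follows. (a) If $p\equiv1\pmod4$, then $m=4t$ for some $t\in\mathbb N$ and $$\mathrm{Spec}(\Gamma(4,q))=\Big\{[n]^1,\Big[\tfrac{\sqrt q+4d\sqrt[4]q-1}{4}\Big]^n,\Big[\tfrac{\sqrt q-4d\sqrt[4]q-1}{4}\Big]^n,\Big[\tfrac{-\sqrt q+2c\sqrt[4]q-1}{4}\Big]^n,\Big[\tfrac{-\sqrt q-2c\sqrt[4]q-1}{4}\Big]^n\Big\},$$ where $c,d$ are integers (with $c$ unique, $d$ unique up to sign) determined by $\sqrt q=c^2+4d^2$, $c\equiv1\pmod4$, $\gcd(c,p)=1$. (b) If $p\equiv3\pmod4$, then $m=2t$ for some $t\in\mathbb N$ and $$\mathrm{Spec}(\Gamma(4,q))=\begin{cases}\{[n]^1,[\frac{\sqrt q-1}{4}]^{3n},[-\frac{3\sqrt q+1}{4}]^n\} & m\equiv0\pmod4,\\ \{[n]^1,[\frac{3\sqrt q-1}{4}]^{n},[\frac{-\sqrt q-1}{4}]^{3n}\} & m\equiv2\pmod4;\end{cases}$$ in particular $\Gamma(4,q)$ is strongly regular in this case.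
   Context: Let $p$ be prime, $q=p^m$, $R_4=\{x^4:x\in\mathbb F_q^*\}$, and $\Gamma(4,q)$ the Cayley graph on $\mathbb F_q$ in which $u\to v$ is an edge iff $v-u\in R_4$. Spectrum = multiset of adjacency eigenvalues, written $\{[\lambda]^{\text{mult}}\}$. *)

theory Defs
  imports "HOL-Analysis.Analysis" "HOL-Computational_Algebra.Polynomial"
begin

definition R4 :: "'a::field set" where
  "R4 = {x ^ 4 | x. x \<noteq> 0}"

definition gamma4_edge :: "'a::field \<Rightarrow> 'a \<Rightarrow> bool" where
  "gamma4_edge u v \<longleftrightarrow> v - u \<in> R4"

definition gamma4_adj :: "complex ^ ('a::{finite,field}) ^ ('a::{finite,field})" where
  "gamma4_adj = (\<chi> u v. if gamma4_edge u v then 1 else 0)"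

definition charpoly_vec :: "'b::idom ^ 'n ^ 'n \<Rightarrow> 'b poly" where
  "charpoly_vec A = det (\<chi> i j. (if i = j then [:0, 1:] else 0) - [: A $ i $ j :])"

definition spectrum_mset :: "complex ^ 'n ^ 'n \<Rightarrow> complex multiset" where
  "spectrum_mset A = proots (charpoly_vec A)"

definition digraph_connected :: "('a \<Rightarrow> 'a \<Rightarrow> bool) \<Rightarrow> bool" where
  "digraph_connected E \<longleftrightarrow> (\<forall>u v. E\<^sup>*\<^sup>* u v)"

definition integral_spectrum :: "complex ^ 'n ^ 'n \<Rightarrow> bool" where
  "integral_spectrum A \<longleftrightarrow> (\<forall>x \<in># spectrum_mset A. x \<in> \<int>)"

definition strongly_regular :: "('a::finite \<Rightarrow> 'a \<Rightarrow> bool) \<Rightarrow> bool" where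
  "strongly_regular E \<longleftrightarrow>
     (\<forall>u v. E u v \<longleftrightarrow> E v u) \<and> (\<forall>u. \<not> E u u) \<and>
     (\<exists>k la mu :: nat.
        (\<forall>u. card {w. E u w} = k) \<and>
        (\<forall>u v. E u v \<longrightarrow> card {w. E u w \<and> E v w} = la) \<and>
        (\<forall>u v. u \<noteq> v \<longrightarrow> \<not> E u v \<longrightarrow> card {w. E u w \<and> E v w} = mu))"

end

theory Submission
  imports Defs "HOL-Number_Theory.Residues"
begin

text \<open>
  The eigenvalues of the Cayley graph are the degree \<open>n\<close> and the four quartic Gaussian periods
  \<open>\<eta>\<^sub>j = \<Sum>x \<in> R\<^sub>4. \<psi> (g^j x)\<close>, each with multiplicity \<open>n\<close>. Since \<open>4\<close> divides \<open>(q - 1)/(p - 1)\<close>, the prime field lies in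
  \<open>R\<^sub>4 \<union> {0}\<close>, and therefore the periods are rational integers. The Gauss sums of the quartic character and of its
  square are \<open>(\<eta>\<^sub>0 - \<eta>\<^sub>2) + i (\<eta>\<^sub>1 - \<eta>\<^sub>3)\<close> and \<open>\<eta>\<^sub>0 - \<eta>\<^sub>1 + \<eta>\<^sub>2 - \<eta>\<^sub>3\<close>; both have absolute value \<open>sqrt q\<close>.
  So \<open>q\<close> is written as the sum of the integer squares \<open>A\<^sup>2 + B\<^sup>2\<close>, \<open>A = \<eta>\<^sub>0 - \<eta>\<^sub>2\<close>, \<open>B = \<eta>\<^sub>1 - \<eta>\<^sub>3\<close>.

  If \<open>p \<equiv> 3 (mod 4)\<close>, then \<open>p\<close> is inert in the Gaussian integers, so \<open>A = 0\<close> or \<open>B = 0\<close>. If \<open>p \<equiv> 1 (mod 4)\<close>, then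
  \<open>(A + i B)\<^sup>2\<close> is \<open>\<plusminus> sqrt q\<close> times a Jacobi sum, which is congruent to \<open>\<plusminus> (3n choose n)\<close> modulo a prime above \<open>p\<close>
  and hence not divisible by \<open>p\<close>; so exactly \<open>q^(1/4)\<close> divides both \<open>A\<close> and \<open>B\<close>. All signs that remain are determined
  by the integrality of the periods, because \<open>4 \<eta>\<^sub>j + 1 \<equiv> 1 (mod 4)\<close>.
\<close>

section \<open>Sums of two squares and binomial coefficients\<close>

text \<open>Here \<open>(p - 1) / 2\<close> is odd. If \<open>p\<close> divided neither number,
  raising \<open>a^2 = - b^2\<close> to this power would give \<open>1 = - 1\<close> modulo
  \<open>p\<close> by Fermat's theorem.\<close>

lemma prime_3_mod_4_dvd_sum_squares:
  fixes p :: nat and a b :: int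
  assumes p: "prime p" "p mod 4 = 3" and dvd: "int p dvd a\<^sup>2 + b\<^sup>2"
  shows "int p dvd a"
proof (rule ccontr)
  assume na: "\<not> int p dvd a"
  have pp: "prime (int p)" using p by simp
  have nb: "\<not> int p dvd b"
  proof
    assume "int p dvd b"
    hence "int p dvd a\<^sup>2" using dvd by (simp add: dvd_add_left_iff power2_eq_square)
    thus False using na pp by (simp add: prime_dvd_power_iff)
  qed
  obtain j where j: "p = 4 * j + 3" using p(2) by (metis mult_div_mod_eq)
  have e: "p - 1 = 2 * (2 * j + 1)" using j by simp
  have fa: "[x ^ (p - 1) = 1] (mod int p)" if "\<not> int p dvd x" for x :: int
  proof -
    have "\<not> p dvd nat \<bar>x\<bar>" using that by (simp add: int_dvd_int_iff[symmetric])
    hence "[nat \<bar>x\<bar> ^ (p - 1) = 1] (mod p)" using p(1) fermat_theorem by blast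
    hence "[int (nat \<bar>x\<bar> ^ (p - 1)) = int 1] (mod int p)" by (simp only: cong_int_iff)
    moreover have "even (p - 1)" using e by simp
    ultimately show ?thesis by (simp add: power_even_abs)
  qed
  have "[a\<^sup>2 = - (b\<^sup>2)] (mod int p)" using dvd by (simp add: cong_iff_dvd_diff)
  hence "[(a\<^sup>2) ^ (2 * j + 1) = (- (b\<^sup>2)) ^ (2 * j + 1)] (mod int p)" by (rule cong_pow)
  moreover have "(- (b\<^sup>2)) ^ (2 * j + 1) = - (b ^ (p - 1))" "(a\<^sup>2) ^ (2 * j + 1) = a ^ (p - 1)"
    unfolding e power_mult by (rule power_minus_odd, simp) (rule refl)
  ultimately have "[a ^ (p - 1) = - (b ^ (p - 1))] (mod int p)" by simp
  moreover have "[- (b ^ (p - 1)) = - 1] (mod int p)" using fa[OF nb] by (simp add: cong_minus_minus_iff)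
  ultimately have "[1 = - 1] (mod int p)" using fa[OF na] by (meson cong_sym cong_trans)
  hence "int p dvd 2" by (simp add: cong_iff_dvd_diff)
  hence "int p \<le> 2" by (rule zdvd_imp_le) simp
  thus False using j by simp
qed

text \<open>Descent: \<open>p\<close> divides both \<open>a\<close> and \<open>b\<close>, so
  \<open>p^2\<close> can be cancelled until the sum of squares is 1.\<close>

lemma sum_squares_eq_inert_prime_power:
  fixes p s :: nat and a b :: int
  assumes p: "prime p" "p mod 4 = 3" and "a\<^sup>2 + b\<^sup>2 = int p ^ (2 * s)"
  shows "a = 0 \<or> b = 0"
  using assms(3)
proof (induction s arbitrary: a b)
  case 0
  have "a\<^sup>2 + b\<^sup>2 = 1" using 0 by simp
  moreover have "x\<^sup>2 \<ge> 1" if "x \<noteq> 0" for x :: int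
    using that by (simp add: int_one_le_iff_zero_less)
  ultimately show ?case by (metis add_mono_thms_linordered_semiring(1) one_add_one not_numeral_le_zero
        numeral_le_one_iff semiring_norm(69))
next
  case (Suc s)
  have "int p dvd a\<^sup>2 + b\<^sup>2" "int p dvd b\<^sup>2 + a\<^sup>2" using Suc.prems by (auto simp: add.commute)
  hence "int p dvd a" "int p dvd b"
    using prime_3_mod_4_dvd_sum_squares[OF p] by blast+
  then obtain a' b' where ab: "a = int p * a'" "b = int p * b'" by (auto elim!: dvdE)
  have "(int p)\<^sup>2 * (a'\<^sup>2 + b'\<^sup>2) = (int p)\<^sup>2 * int p ^ (2 * s)"
    using Suc.prems by (simp add: ab power2_eq_square algebra_simps)
  hence "a'\<^sup>2 + b'\<^sup>2 = int p ^ (2 * s)" using p by (auto simp: prime_gt_0_nat)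
  thus ?case using Suc.IH ab by auto
qed

text \<open>\<open>N = p ^ k\<close> divides the product of \<open>2 * (c * d' - c' * d)\<close> and
  \<open>2 * (c * d' + c' * d)\<close>. If \<open>p\<close> divided both factors, it would divide
  their sum \<open>4 * c * d'\<close>, which is impossible for \<open>k > 0\<close>; so
  \<open>N\<close> divides one of them, and a size estimate makes that factor vanish.\<close>

lemma sum_two_squares_prime_power_unique:
  fixes p k :: nat and c d c' d' :: int
  assumes p: "prime p" "odd p"
    and cd: "c\<^sup>2 + 4 * d\<^sup>2 = int p ^ k" "\<not> int p dvd c"
    and cd': "c'\<^sup>2 + 4 * d'\<^sup>2 = int p ^ k" "\<not> int p dvd c'"
  shows "c\<^sup>2 = c'\<^sup>2 \<and> d\<^sup>2 = d'\<^sup>2"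
proof -
  define N where "N = int p ^ k"
  have pp: "prime (int p)" using p by simp
  have Npos: "N > 0" using p by (simp add: N_def prime_gt_0_nat)
  have Nodd: "odd N" using p by (simp add: N_def)
  \<comment> \<open>Here \<open>e\<close> stands for \<open>d'\<close> or \<open>- d'\<close>. By
    the Brahmagupta identity \<open>v^2 + w^2 = N^2\<close>. Since \<open>v\<close> is odd, it is
    nonzero, so \<open>\<bar>w\<bar> < N\<close>, and divisibility by \<open>N\<close> leaves only
    \<open>w = 0\<close>.\<close>
  have main: "c\<^sup>2 = c'\<^sup>2" if cd'': "c'\<^sup>2 + 4 * e\<^sup>2 = N" and dv: "N dvd 2 * (c * e - c' * d)" for e
  proof -
    define w where "w = 2 * (c * e - c' * d)"
    define v where "v = c * c' + 4 * d * e"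
    have id: "v\<^sup>2 + w\<^sup>2 = N\<^sup>2"
    proof -
      have "v\<^sup>2 + w\<^sup>2 = (c\<^sup>2 + 4 * d\<^sup>2) * (c'\<^sup>2 + 4 * e\<^sup>2)"
        unfolding v_def w_def by (simp add: power2_eq_square algebra_simps)
      thus ?thesis using cd cd'' by (simp add: N_def power2_eq_square)
    qed
    have "odd (c\<^sup>2 + 4 * d\<^sup>2)" "odd (c'\<^sup>2 + 4 * e\<^sup>2)" using cd(1) cd'' Nodd by (simp_all add: N_def)
    hence "odd c" "odd c'" by simp_all
    hence "odd v" unfolding v_def by simp
    hence "v \<noteq> 0" by auto
    hence "v\<^sup>2 > 0" by simp
    hence "w\<^sup>2 < N\<^sup>2" using id by linarith
    hence "\<bar>w\<bar> < N" using Npos by (metis abs_of_pos power2_less_imp_less abs_ge_zero less_imp_le power2_abs)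
    hence "w = 0" using dv zdvd_imp_le[of N "\<bar>w\<bar>"] unfolding w_def[symmetric] by force
    hence eq: "c * e = c' * d" by (simp add: w_def)
    have "c\<^sup>2 * N = c\<^sup>2 * c'\<^sup>2 + 4 * (c * e)\<^sup>2"
      by (simp add: power2_eq_square algebra_simps flip: cd'')
    also have "\<dots> = c'\<^sup>2 * N" unfolding eq N_def
      by (simp add: power2_eq_square algebra_simps flip: cd(1))
    finally show ?thesis using Npos by simp
  qed
  have "(2 * (c * d' - c' * d)) * (2 * (c * d' + c' * d)) = c\<^sup>2 * (4 * d'\<^sup>2) - c'\<^sup>2 * (4 * d\<^sup>2)"
    by (simp add: power2_eq_square algebra_simps)
  also have "4 * d'\<^sup>2 = N - c'\<^sup>2" using cd'(1) by (simp add: N_def)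
  also have "4 * d\<^sup>2 = N - c\<^sup>2" using cd(1) by (simp add: N_def)
  also have "c\<^sup>2 * (N - c'\<^sup>2) - c'\<^sup>2 * (N - c\<^sup>2) = N * (c\<^sup>2 - c'\<^sup>2)" by (simp add: algebra_simps)
  finally have prd: "N dvd (2 * (c * d' - c' * d)) * (2 * (c * d' + c' * d))" by simp
  have "N dvd 2 * (c * d' - c' * d) \<or> N dvd 2 * (c * d' + c' * d)"
  proof (cases "int p dvd 2 * (c * d' - c' * d)")
    case False
    hence "coprime (int p) (2 * (c * d' - c' * d))" using pp by (simp add: prime_imp_coprime)
    hence "coprime N (2 * (c * d' - c' * d))" by (simp add: N_def)
    thus ?thesis using prd by (simp add: coprime_dvd_mult_right_iff)
  next
    case True
    show ?thesis
    proof (cases "k = 0")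
      case True thus ?thesis by (simp add: N_def)
    next
      case k: False
      have n2: "\<not> int p dvd 2" using p by (metis even_of_nat_iff int_dvd_int_iff of_nat_numeral primes_dvd_imp_eq two_is_prime_nat even_numeral)
      have nd': "\<not> int p dvd d'"
      proof
        assume "int p dvd d'"
        moreover have "int p dvd c'\<^sup>2 + 4 * d'\<^sup>2" using cd'(1) k by (simp add: dvd_power)
        ultimately have "int p dvd c'\<^sup>2" by (metis dvd_add_left_iff dvd_mult dvd_power_same dvd_trans dvd_power zero_less_numeral power2_eq_square dvd_mult2)
        thus False using cd'(2) pp by (simp add: prime_dvd_power_iff)
      qed
      have "\<not> int p dvd 2 * (c * d' + c' * d)"
      proof
        assume "int p dvd 2 * (c * d' + c' * d)"
        hence "int p dvd 2 * (c * d' - c' * d) + 2 * (c * d' + c' * d)" using True by (rule dvd_add[rotated])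
        hence "int p dvd 2 * 2 * c * d'" by (simp add: algebra_simps)
        thus False using n2 cd(2) nd' pp by (simp only: prime_dvd_mult_iff simp_thms)
      qed
      hence "coprime (int p) (2 * (c * d' + c' * d))" using pp by (simp add: prime_imp_coprime)
      hence "coprime N (2 * (c * d' + c' * d))" by (simp add: N_def)
      thus ?thesis using prd by (simp add: coprime_dvd_mult_left_iff)
    qed
  qed
  hence "c\<^sup>2 = c'\<^sup>2" using main[of d'] main[of "- d'"] cd'(1)
    by (auto simp: N_def algebra_simps dvd_minus_iff) (metis add_uminus_conv_diff dvd_minus_iff minus_add_distrib minus_diff_eq uminus_add_conv_diff add.commute)
  thus ?thesis using cd(1) cd'(1) by simp
qed

section \<open>Valuations of factorials and binomial coefficients, one base-p digit at a
  time\<close>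

text \<open>One step of Legendre's formula: only the factors \<open>p * 1, ..., p * a\<close> are
  divisible by \<open>p\<close>, and they contribute \<open>a\<close> plus the valuation of
  \<open>a!\<close>.\<close>

lemma multiplicity_fact_digits:
  fixes p a r :: nat
  assumes p: "prime p" and "r < p"
  shows "multiplicity p (fact (p * a + r) :: nat) = a + multiplicity p (fact a :: nat)"
  using assms(2)
proof (induction a arbitrary: r)
  case 0
  have "\<not> p dvd fact r" using p 0 by (simp add: prime_dvd_fact_iff)
  thus ?case using p by (simp add: not_dvd_imp_multiplicity_0)
next
  case (Suc a)
  have p0: "p > 0" using p by (simp add: prime_gt_0_nat)
  have pe: "prime_elem p" using p by simp
  show ?case using Suc.prems
  proof (induction r)
    case 0
    have "fact (p * Suc a) = (p * Suc a) * (fact (p * a + (p - 1)) :: nat)"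
      using p0 by (subst fact_reduce) (auto simp: algebra_simps)
    hence "multiplicity p (fact (p * Suc a) :: nat)
        = multiplicity p (p * Suc a) + multiplicity p (fact (p * a + (p - 1)) :: nat)"
      using pe p0 by (simp add: prime_elem_multiplicity_mult_distrib del: mult_Suc_right mult_Suc)
    also have "\<dots> = 1 + multiplicity p (Suc a) + (a + multiplicity p (fact a :: nat))"
      using Suc.IH[of "p - 1"] pe p0
      by (subst prime_elem_multiplicity_mult_distrib) auto
    also have "multiplicity p (fact (Suc a) :: nat) = multiplicity p (Suc a) + multiplicity p (fact a :: nat)"
      unfolding fact_Suc of_nat_id using pe by (subst prime_elem_multiplicity_mult_distrib) auto
    ultimately show ?case by simp
  next
    case (Suc r)
    have nd: "\<not> p dvd Suc (p * Suc a + r)"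
    proof
      assume "p dvd Suc (p * Suc a + r)"
      hence "p dvd p * Suc a + Suc r" by simp
      hence "p dvd Suc r" using dvd_add_right_iff[of p "p * Suc a" "Suc r"] by simp
      thus False using Suc.prems by (simp add: nat_dvd_not_less)
    qed
    have "multiplicity p (fact (p * Suc a + Suc r) :: nat)
       = multiplicity p (Suc (p * Suc a + r)) + multiplicity p (fact (p * Suc a + r) :: nat)"
      unfolding add_Suc_right fact_Suc of_nat_id using pe by (subst prime_elem_multiplicity_mult_distrib) auto
    thus ?case using Suc nd by (simp add: not_dvd_imp_multiplicity_0)
  qed
qed

text \<open>One step of Kummer's theorem: since \<open>s \<le> r\<close>, subtracting the last
  digits needs no borrow, and the contributions \<open>b\<close> and \<open>a - b\<close> of the
  lower factorials cancel against \<open>a\<close>.\<close>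

lemma multiplicity_binomial_digits:
  fixes p a b r s :: nat
  assumes p: "prime p" and "r < p" "s \<le> r" "b \<le> a"
  shows "multiplicity p ((p * a + r) choose (p * b + s)) = multiplicity p (a choose b)"
proof -
  have pe: "prime_elem p" using p by simp
  have bin: "multiplicity p (fact k :: nat) + multiplicity p (fact (n - k) :: nat) + multiplicity p (n choose k)
      = multiplicity p (fact n :: nat)" if "k \<le> n" for n k
    using that pe by (simp add: prime_elem_multiplicity_mult_distrib flip: binomial_fact_lemma[OF that])
  have le: "p * b + s \<le> p * a + r" using assms by (simp add: add_le_mono)
  have "p * a + r - (p * b + s) = p * (a - b) + (r - s)"
    using assms mult_le_mono2[OF assms(4), of p] by (simp add: diff_mult_distrib2)
  moreover have "multiplicity p (fact (p * (a - b) + (r - s)) :: nat) = a - b + multiplicity p (fact (a - b) :: nat)"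
    using assms by (intro multiplicity_fact_digits) auto
  ultimately have "b + multiplicity p (fact b :: nat) + (a - b + multiplicity p (fact (a - b) :: nat))
       + multiplicity p ((p * a + r) choose (p * b + s)) = a + multiplicity p (fact a :: nat)"
    using bin[OF le] multiplicity_fact_digits[OF p, of r a] multiplicity_fact_digits[OF p, of s b] assms
    by (simp del: diff_add_assoc)
  thus ?thesis using bin[OF assms(4)] assms(4) by simp
qed

text \<open>All base-\<open>p\<close> digits of \<open>n\<close> are \<open>(p - 1) / 4\<close>, so there are no carries in \<open>n + 2 n\<close>.\<close>

lemma not_dvd_binomial_quarter:
  fixes p n m :: nat
  assumes p: "prime p" "p mod 4 = 1" and "4 * n + 1 = p ^ m"
  shows "\<not> p dvd (3 * n choose n)"
proof -
  obtain j where j: "p = 4 * j + 1" using p(2) by (metis mult_div_mod_eq)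
  have "multiplicity p (3 * n choose n) = 0"
    using assms(3)
  proof (induction m arbitrary: n)
    case 0 thus ?case by simp
  next
    case (Suc m)
    define k where "k = (p ^ m - 1) div 4"
    have "[p ^ m = 1 ^ m] (mod 4)" using p(2) by (intro cong_pow) (simp add: cong_def)
    hence "p ^ m mod 4 = 1" by (simp add: cong_def)
    hence k: "4 * k + 1 = p ^ m" unfolding k_def by presburger
    \<comment> \<open>Splitting one factor \<open>p\<close> off \<open>4 * n + 1\<close> exposes the
      last digit: \<open>n = p * k + j\<close> with \<open>j = (p - 1) / 4\<close>, and
      \<open>k\<close> has the same shape for the exponent \<open>m\<close>.\<close>
    have "4 * n + 1 = (4 * j + 1) * (4 * k + 1)" using Suc.prems k j by simp
    hence n: "n = p * k + j" using j by (simp add: algebra_simps)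
    have n3: "3 * n = p * (3 * k) + 3 * j" using n by simp
    show ?case unfolding n3 unfolding n
      using multiplicity_binomial_digits[of p "3 * j" j k "3 * k"] p j Suc.IH[OF k] by simp
  qed
  moreover have "(3 * n choose n) \<noteq> 0" by simp
  ultimately show ?thesis using p by (metis prime_multiplicity_gt_zero_iff neq0_conv prime_imp_prime_elem)
qed

text \<open>The hypotheses say \<open>(A + i B)^2 = G (U + i V)\<close>. With
  \<open>P = p ^ t\<close> one has \<open>G = P^2\<close> or \<open>G = - P^2\<close>, so
  \<open>P^2\<close> divides \<open>2 A^2\<close> and \<open>2 B^2\<close>, whence \<open>P\<close>
  divides \<open>A\<close> and \<open>B\<close>. Were the quotients \<open>a\<close>,
  \<open>b\<close> still divisible by \<open>p\<close>, then so would be \<open>U\<close> and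
  \<open>V\<close>.\<close>

lemma exact_power_dvd_of_square:
  fixes p t :: nat and A B G U V :: int
  assumes p: "prime p" "odd p" and t: "t > 0"
    and norm: "A\<^sup>2 + B\<^sup>2 = int p ^ (4 * t)" and G: "G\<^sup>2 = int p ^ (4 * t)"
    and re: "A\<^sup>2 - B\<^sup>2 = G * U" and im: "2 * A * B = G * V"
    and UV: "\<not> (int p dvd U \<and> int p dvd V)"
  obtains a b where "A = int p ^ t * a" "B = int p ^ t * b" "a\<^sup>2 + b\<^sup>2 = int p ^ (2 * t)"
    "\<not> int p dvd a" "\<not> int p dvd b"
proof -
  define P where "P = int p ^ t"
  have pp: "prime (int p)" using p by simp
  have P0: "P > 0" using p by (simp add: P_def prime_gt_0_nat)
  have P4: "int p ^ (4 * t) = P ^ 4" by (simp add: P_def power_mult mult.commute)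
  have P2: "int p ^ (2 * t) = P\<^sup>2" by (simp add: P_def power_mult mult.commute)
  have pP: "int p dvd P" using t by (simp add: P_def)
  have "G\<^sup>2 = (P\<^sup>2)\<^sup>2" using G P4 by simp
  hence GP: "G = P\<^sup>2 \<or> G = - (P\<^sup>2)" by (rule power2_eq_iff[THEN iffD1])
  have cop: "coprime (P\<^sup>2) 2" using p by (simp add: P_def coprime_right_2_iff_odd)
  have "2 * A\<^sup>2 = P\<^sup>2 * P\<^sup>2 + G * U" "2 * B\<^sup>2 = P\<^sup>2 * P\<^sup>2 - G * U"
    using norm re P4 by (simp_all add: power4_eq_xxxx power2_eq_square)
  hence "P\<^sup>2 dvd 2 * A\<^sup>2" "P\<^sup>2 dvd 2 * B\<^sup>2" using GP
    by (metis dvd_add dvd_diff dvd_triv_left dvd_mult2 dvd_minus_iff dvd_refl)+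
  hence "P\<^sup>2 dvd A\<^sup>2" "P\<^sup>2 dvd B\<^sup>2" using cop by (simp_all add: coprime_dvd_mult_right_iff)
  hence "P dvd A" "P dvd B" by simp_all
  then obtain a b where ab: "A = P * a" "B = P * b" by (auto elim!: dvdE)
  have s: "a\<^sup>2 + b\<^sup>2 = P\<^sup>2"
  proof -
    have "P\<^sup>2 * (a\<^sup>2 + b\<^sup>2) = P\<^sup>2 * P\<^sup>2" using norm P4 ab
      by (simp add: algebra_simps power4_eq_xxxx power2_eq_square)
    thus ?thesis using P0 by (metis mult_cancel_left not_less_iff_gr_or_eq zero_less_power)
  qed
  have iff: "int p dvd a \<longleftrightarrow> int p dvd b"
  proof -
    have "int p dvd a\<^sup>2 + b\<^sup>2" using s pP by (simp add: power2_eq_square)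
    hence "int p dvd a\<^sup>2 \<longleftrightarrow> int p dvd b\<^sup>2" using dvd_add_right_iff dvd_add_left_iff by blast
    thus ?thesis using pp by (simp add: prime_dvd_power_iff)
  qed
  have "\<not> int p dvd a"
  proof
    assume da: "int p dvd a"
    hence db: "int p dvd b" using iff by simp
    obtain e where e: "G = P\<^sup>2 * e" "e = 1 \<or> e = - 1" using GP by force
    have "P\<^sup>2 * (a\<^sup>2 - b\<^sup>2) = P\<^sup>2 * (e * U)" "P\<^sup>2 * (2 * a * b) = P\<^sup>2 * (e * V)" using re im ab e(1)
      by (simp_all add: algebra_simps power2_eq_square)
    hence "a\<^sup>2 - b\<^sup>2 = e * U" "2 * a * b = e * V"
      using P0 by (metis mult_cancel_left not_less_iff_gr_or_eq zero_less_power)+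
    moreover have "int p dvd a\<^sup>2 - b\<^sup>2" "int p dvd 2 * a * b" using da db by (simp_all add: power2_eq_square)
    ultimately have "int p dvd U" "int p dvd V" using e(2) by auto
    thus False using UV by simp
  qed
  thus thesis using that[of a b] ab s iff P2 by (simp add: P_def)
qed

section \<open>Finite fields and additive characters\<close>

lemma CHAR_eq_of_CARD_eq_prime_power:
  fixes p m :: nat
  assumes "prime p" "CARD('a::{finite,field}) = p ^ m"
  shows "CHAR('a::{finite,field}) = p"
proof -
  have "CHAR('a) > 0" by (rule finite_imp_CHAR_pos) simp
  hence pr: "prime CHAR('a)" by (rule prime_CHAR_semidom)
  have "CHAR('a) dvd p ^ m" using CHAR_dvd_CARD[where ?'a = 'a] assms by simp
  hence "CHAR('a) dvd p" using pr by (rule prime_dvd_power[rotated])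
  thus ?thesis using pr assms by (simp add: primes_dvd_imp_eq)
qed

lemma of_nat_power_CHAR:
  "(of_nat k :: 'a::{finite,field}) ^ CHAR('a) = of_nat k"
proof -
  have "CHAR('a) > 0" by (rule finite_imp_CHAR_pos) simp
  moreover from this have "prime CHAR('a)" by (rule prime_CHAR_semidom)
  ultimately show ?thesis by (induction k) (auto simp: freshmans_dream)
qed

lemma power_CARD_minus_1:
  fixes x :: "'a::{finite,field}"
  assumes "x \<noteq> 0"
  shows "x ^ (CARD('a) - 1) = 1"
proof -
  have "(\<Prod>y\<in>UNIV-{0}. y) = (\<Prod>y\<in>UNIV-{0}. x * y)"
    by (rule prod.reindex_bij_witness[of _ "\<lambda>y. x * y" "\<lambda>y. y / x"]) (use assms in auto)
  also have "\<dots> = x ^ (CARD('a) - 1) * \<Prod>(UNIV-{0})"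
    by (simp add: prod.distrib)
  finally show ?thesis by simp
qed

lemma power_CARD:
  fixes x :: "'a::{finite,field}"
  shows "x ^ CARD('a) = x"
proof (cases "x = 0")
  case False
  have "x ^ CARD('a) = x * x ^ (CARD('a) - 1)"
    using power_minus_mult[of "CARD('a)" x] by (simp add: mult.commute)
  thus ?thesis using power_CARD_minus_1[OF False] by simp
qed simp

lemma card_nth_roots_le:
  fixes c :: "'a::field"
  assumes "k > 0"
  shows "card {x. x ^ k = c} \<le> k"
proof -
  let ?f = "Polynomial.monom 1 k + [:- c:]"
  have d: "degree ?f = k" using assms
    by (subst degree_add_eq_left) (auto simp: degree_monom_eq)
  hence "?f \<noteq> 0" using assms by auto
  hence "card {x. poly ?f x = 0} \<le> k" using card_poly_roots_bound[of ?f] d by simp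
  thus ?thesis by (simp add: poly_monom)
qed

text \<open>A root count that replaces a generator of the multiplicative group:
  \<open>X^e - 1\<close> has too few roots to vanish on all units.\<close>

lemma exists_power_neq_1:
  fixes e :: nat
  assumes "0 < e" "e < CARD('a::{finite,field}) - 1"
  obtains g :: "'a::{finite,field}" where "g \<noteq> 0" "g ^ e \<noteq> 1"
proof -
  have "card (UNIV - {0 :: 'a}) > card {x :: 'a. x ^ e = 1}"
    using card_nth_roots_le[OF assms(1), of "1 :: 'a"] assms by simp
  hence "\<not> UNIV - {0 :: 'a} \<subseteq> {x :: 'a. x ^ e = 1}"
    by (meson card_mono finite leD)
  thus thesis using that by auto
qed

lemma sum_UNIV_power_eq_0:
  assumes "0 < e" "e < CARD('a::{finite,field}) - 1"
  shows "(\<Sum>x\<in>UNIV. x ^ e) = (0 :: 'a::{finite,field})"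
proof -
  obtain g :: 'a where g: "g \<noteq> 0" "g ^ e \<noteq> 1" using exists_power_neq_1[OF assms] .
  have "(\<Sum>x\<in>UNIV. x ^ e) = (\<Sum>x\<in>UNIV. (g * x) ^ e)"
    by (rule sum.reindex_bij_witness[of _ "\<lambda>y. g * y" "\<lambda>y. y / g"]) (use g in auto)
  also have "\<dots> = g ^ e * (\<Sum>x\<in>UNIV. x ^ e)" by (simp add: power_mult_distrib sum_distrib_left)
  finally show ?thesis using g by simp
qed

lemma sum_UNIV_power_CARD_minus_1:
  "(\<Sum>x\<in>UNIV. x ^ (CARD('a) - 1)) = (- 1 :: 'a::{finite,field})"
proof -
  have "card {0, 1 :: 'a} \<le> CARD('a)" by (rule card_mono) auto
  hence c: "CARD('a) > 1" by simp
  have "(\<Sum>x\<in>UNIV. x ^ (CARD('a) - 1)) = (\<Sum>x::'a\<in>UNIV. if x = 0 then 0 else (1 :: 'a))"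
    by (rule sum.cong) (use c power_CARD_minus_1 in auto)
  also have "\<dots> = of_nat (card (UNIV - {0 :: 'a}))"
    by (simp add: sum.If_cases Compl_eq_Diff_UNIV)
  also have "card (UNIV - {0 :: 'a}) = CARD('a) - 1" by simp
  also have "of_nat (CARD('a) - 1) = (of_nat CARD('a) - 1 :: 'a)" using c by (simp add: of_nat_diff)
  also have "of_nat CARD('a) = (0 :: 'a)" using CHAR_dvd_CARD[where ?'a = 'a] by (simp add: of_nat_eq_0_iff_char_dvd)
  finally show ?thesis by simp
qed

section \<open>Additive characters: orthogonality, Fourier inversion, existence\<close>

locale additive_character =
  fixes \<psi> :: "'a::{finite,field} \<Rightarrow> complex"
  assumes psi_add: "\<psi> (x + y) = \<psi> x * \<psi> y" and psi_0: "\<psi> 0 = 1"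
    and psi_nontrivial: "\<exists>x. \<psi> x \<noteq> 1"
begin

lemma psi_of_nat_mult: "\<psi> (of_nat k * x) = \<psi> x ^ k"
  by (induction k) (simp_all add: psi_0 psi_add algebra_simps)

lemma psi_power_CHAR: "\<psi> x ^ CHAR('a) = 1"
  using psi_of_nat_mult[of "CHAR('a)" x] by (simp add: psi_0)

lemma norm_psi: "norm (\<psi> x) = 1"
proof -
  have "CHAR('a) > 0" by (rule finite_imp_CHAR_pos) simp
  moreover have "norm (\<psi> x) ^ CHAR('a) = 1" using psi_power_CHAR[of x] by (metis norm_one norm_power)
  ultimately show ?thesis by (metis norm_ge_zero power_eq_1_iff real_norm_def abs_of_nonneg neq0_conv)
qed

lemma cnj_psi: "cnj (\<psi> x) = \<psi> (- x)"
proof -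
  have "\<psi> x * cnj (\<psi> x) = 1" using norm_psi[of x] by (simp add: complex_norm_square[symmetric])
  moreover have "\<psi> x * \<psi> (- x) = 1" by (simp add: psi_0 flip: psi_add)
  ultimately show ?thesis by (metis mult_cancel_left zero_neq_one mult_zero_left)
qed

lemma sum_psi: "(\<Sum>x\<in>UNIV. \<psi> x) = 0"
proof -
  obtain a where a: "\<psi> a \<noteq> 1" using psi_nontrivial by blast
  have "(\<Sum>x\<in>UNIV. \<psi> x) = (\<Sum>x\<in>UNIV. \<psi> (a + x))"
    by (rule sum.reindex_bij_witness[of _ "\<lambda>y. a + y" "\<lambda>y. y - a"]) auto
  also have "\<dots> = \<psi> a * (\<Sum>x\<in>UNIV. \<psi> x)" by (simp add: psi_add sum_distrib_left)
  finally show ?thesis using a by simp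
qed

lemma sum_psi_mult: "(\<Sum>x\<in>UNIV. \<psi> (b * x)) = (if b = 0 then of_nat CARD('a) else 0)"
proof (cases "b = 0")
  case False
  have "(\<Sum>x\<in>UNIV. \<psi> (b * x)) = (\<Sum>x\<in>UNIV. \<psi> x)"
    by (rule sum.reindex_bij_witness[of _ "\<lambda>y. y / b" "\<lambda>y. b * y"]) (use False in auto)
  thus ?thesis using False sum_psi by simp
qed (simp add: psi_0)

text \<open>By Fourier inversion only the frequency \<open>b = 0\<close> contributes to
  \<open>f y\<close>, and this contribution does not depend on \<open>y\<close>.\<close>

lemma constant_if_fourier_vanishes:
  assumes "\<And>b. b \<noteq> 0 \<Longrightarrow> (\<Sum>x\<in>UNIV. f x * \<psi> (b * x)) = 0"
  shows "f y = f z"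
proof -
  have inv: "of_nat CARD('a) * f y = (\<Sum>x\<in>UNIV. f x)" for y
  proof -
    have "(\<Sum>b\<in>UNIV. \<psi> (- (b * y)) * (\<Sum>x\<in>UNIV. f x * \<psi> (b * x)))
        = (\<Sum>b::'a\<in>UNIV. if b = 0 then (\<Sum>x\<in>UNIV. f x) else 0)"
      by (rule sum.cong) (auto simp: assms psi_0)
    moreover have "(\<Sum>b\<in>UNIV. \<psi> (- (b * y)) * (\<Sum>x\<in>UNIV. f x * \<psi> (b * x)))
        = (\<Sum>b\<in>UNIV. \<Sum>x\<in>UNIV. f x * \<psi> ((x - y) * b))"
      by (simp add: sum_distrib_left algebra_simps flip: psi_add)
    also have "\<dots> = (\<Sum>x\<in>UNIV. f x * (\<Sum>b\<in>UNIV. \<psi> ((x - y) * b)))"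
      by (subst sum.swap) (simp add: sum_distrib_left)
    also have "\<dots> = (\<Sum>x\<in>UNIV. if x = y then f x * of_nat CARD('a) else 0)"
      by (rule sum.cong) (auto simp: sum_psi_mult)
    ultimately show ?thesis by (simp add: mult.commute)
  qed
  have "of_nat CARD('a) * f y = of_nat CARD('a) * f z" by (simp add: inv)
  thus ?thesis by simp
qed

end

text \<open>The trace to the prime field, followed by \<open>k \<mapsto> exp (2 pi i k / p)\<close>.
  It is nontrivial because the trace is a polynomial of degree at most \<open>p ^ (m - 1)\<close>,
  less than the number of field elements.\<close>

lemma additive_character_exists:
  fixes p m :: nat
  assumes p: "prime p" and q: "CARD('a::{finite,field}) = p ^ m"
  shows "\<exists>\<psi> :: 'a::{finite,field} \<Rightarrow> complex. additive_character \<psi>"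
proof -
  have ch: "CHAR('a) = p" using CHAR_eq_of_CARD_eq_prime_power[OF p q] .
  have p1: "p > 1" using p by (rule prime_gt_1_nat)
  define tr :: "'a \<Rightarrow> 'a" where "tr x = (\<Sum>i<m. x ^ (p ^ i))" for x
  have tr_add: "tr (x + y) = tr x + tr y" for x y
    unfolding tr_def sum.distrib[symmetric]
    by (rule sum.cong) (auto intro!: freshmans_dream' simp: ch p)
  have tr_p: "tr x ^ p = tr x" for x
  proof -
    \<comment> \<open>Frobenius permutes the summands cyclically, the last one returning to
      \<open>x\<close> because \<open>x ^ q = x\<close>.\<close>
    have "tr x ^ p = (\<Sum>i<m. x ^ (p ^ Suc i))" unfolding tr_def
      by (subst freshmans_dream_sum) (simp_all add: ch p mult.commute flip: power_mult)
    also have "\<dots> + x ^ (p ^ 0) = (\<Sum>i<Suc m. x ^ (p ^ i))" by (subst sum.lessThan_Suc_shift) simp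
    also have "\<dots> = tr x + x" unfolding tr_def using power_CARD[of x] q by simp
    finally show ?thesis by simp
  qed
  \<comment> \<open>\<open>X^p - X\<close> has at most \<open>p\<close> roots, and the
    \<open>p\<close> elements of the prime field already are roots.\<close>
  have fix_eq: "{y :: 'a. y ^ p = y} = of_nat ` {..<p}"
  proof (rule card_seteq[symmetric])
    show "of_nat ` {..<p} \<subseteq> {y :: 'a. y ^ p = y}"
      using of_nat_power_CHAR[where ?'a = 'a] ch by auto
    let ?f = "Polynomial.monom 1 p + [:0, - 1:] :: 'a poly"
    have d: "degree ?f = p" using p1 by (subst degree_add_eq_left) (auto simp: degree_monom_eq)
    hence "?f \<noteq> 0" using p1 by auto
    hence "card {y :: 'a. y ^ p = y} \<le> p" using card_poly_roots_bound[of ?f] d by (simp add: poly_monom)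
    moreover have "inj_on (of_nat :: nat \<Rightarrow> 'a) {..<p}"
      by (rule inj_onI) (auto simp: of_nat_eq_iff_cong_CHAR ch cong_def)
    ultimately show "card {y :: 'a. y ^ p = y} \<le> card (of_nat ` {..<p} :: 'a set)" by (simp add: card_image)
  qed simp
  have "\<exists>k. tr x = of_nat k" for x using tr_p[of x] fix_eq by blast
  \<comment> \<open>The representative \<open>k x\<close> is determined, and additive, only modulo
    \<open>p\<close>; the exponential does not see the difference.\<close>
  then obtain k where k: "\<And>x. tr x = of_nat (k x)" by metis
  define \<psi> where "\<psi> x = exp (2 * of_real pi * \<i> * of_nat (k x) / of_nat p)" for x
  have "additive_character \<psi>"
  proof
    fix x y
    have "(of_nat (k (x + y)) :: 'a) = of_nat (k x + k y)" by (simp add: tr_add flip: k)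
    hence "[k (x + y) = k x + k y] (mod p)" by (simp only: of_nat_eq_iff_cong_CHAR ch)
    hence "\<psi> (x + y) = exp (2 * of_real pi * \<i> * of_nat (k x + k y) / of_nat p)"
      unfolding \<psi>_def using p1 by (subst complex_root_unity_eq) (auto simp: cong_def)
    thus "\<psi> (x + y) = \<psi> x * \<psi> y" by (simp add: \<psi>_def ring_distribs add_divide_distrib exp_add)
  next
    have "(of_nat (k 0) :: 'a) = 0" using p1 by (simp add: tr_def power_0_left flip: k)
    hence "p dvd k 0" by (simp add: of_nat_eq_0_iff_char_dvd ch)
    thus "\<psi> 0 = 1" unfolding \<psi>_def using p1 by (subst complex_root_unity_eq_1) auto
  next
    have m0: "m > 0" using q by (metis One_nat_def UNIV_I card_1_singletonE gr0I power_0 singletonD zero_neq_one)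
    let ?f = "(\<Sum>i<m. Polynomial.monom 1 (p ^ i)) :: 'a poly"
    \<comment> \<open>Only the summand \<open>i = 0\<close> has a linear term, so the coefficient of
      \<open>X\<close> is 1 and the trace polynomial is not zero.\<close>
    have "Polynomial.coeff ?f 1 = (\<Sum>i<m. if i = 0 then 1 else 0)"
      unfolding coeff_sum by (rule sum.cong) (use p1 in auto)
    hence f0: "?f \<noteq> 0" using m0 by auto
    have "degree ?f \<le> p ^ (m - 1)"
      by (rule degree_sum_le) (use p1 in \<open>auto simp: degree_monom_eq\<close>)
    hence "card {x. poly ?f x = 0} \<le> p ^ (m - 1)" using card_poly_roots_bound[OF f0] by linarith
    also have "\<dots> < p ^ m" using m0 p1 by simp
    finally have "{x. poly ?f x = 0} \<noteq> UNIV" using q by auto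
    then obtain x where "poly ?f x \<noteq> 0" by auto
    hence "tr x \<noteq> 0" by (simp add: tr_def poly_sum poly_monom)
    hence "\<not> p dvd k x" by (simp add: k of_nat_eq_0_iff_char_dvd ch)
    hence "\<psi> x \<noteq> 1" unfolding \<psi>_def using p1 by (subst complex_root_unity_eq_1) auto
    thus "\<exists>x. \<psi> x \<noteq> 1" by blast
  qed
  thus ?thesis by blast
qed

section \<open>Cayley spectra and Gauss sums\<close>

context additive_character
begin

text \<open>The characters \<open>u \<mapsto> \<psi> (u * b)\<close> are eigenvectors. Collected as
  the columns of \<open>P\<close> they satisfy \<open>M ** P = P ** D\<close> with \<open>D\<close>
  diagonal, where \<open>M\<close> is the characteristic matrix. By orthogonality
  \<open>P ** Q\<close> is a nonzero multiple of the identity, so \<open>det P\<close> can be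
  cancelled.\<close>

lemma spectrum_cayley:
  "spectrum_mset (\<chi> u v. if v - u \<in> S then 1 else 0) = (\<Sum>b\<in>UNIV. {#\<Sum>x\<in>S. \<psi> (b * x)#})"
proof -
  define lam where "lam b = (\<Sum>x\<in>S. \<psi> (b * x))" for b
  define A :: "complex ^ 'a::{finite,field} ^ 'a::{finite,field}" where "A = (\<chi> u v. if v - u \<in> S then 1 else 0)"
  define M where "M = (\<chi> i j. (if i = j then [:0, 1:] else 0) - [: A $ i $ j :])"
  define P :: "complex poly ^ 'a::{finite,field} ^ 'a::{finite,field}" where "P = (\<chi> u b. [:\<psi> (u * b):])"
  define Q :: "complex poly ^ 'a::{finite,field} ^ 'a::{finite,field}" where "Q = (\<chi> b v. [:\<psi> (- (b * v)):])"
  define D :: "complex poly ^ 'a::{finite,field} ^ 'a::{finite,field}" where "D = (\<chi> b b'. if b = b' then [:- lam b, 1:] else 0)"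
  have const_sum: "(\<Sum>x\<in>X. [:f x:]) = [:\<Sum>x\<in>X. f x:]" for f :: "'a \<Rightarrow> complex" and X
    by (induction X rule: infinite_finite_induct) auto
  have "M ** P = P ** D"
  proof (simp only: vec_eq_iff, intro allI)
    fix u b :: 'a
    have "(M ** P) $ u $ b = (\<Sum>v\<in>UNIV. (if u = v then [:0, 1:] * [:\<psi> (v * b):] else 0) - [:A $ u $ v * \<psi> (v * b):])"
      unfolding matrix_matrix_mult_def M_def P_def by (simp add: left_diff_distrib) (rule sum.cong; simp)
    also have "\<dots> = [:0, 1:] * [:\<psi> (u * b):] - [:\<Sum>v\<in>UNIV. A $ u $ v * \<psi> (v * b):]"
      by (simp add: sum_subtractf const_sum)
    \<comment> \<open>The out-neighbours of \<open>u\<close> are the translates \<open>u + x\<close>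
      with \<open>x \<in> S\<close>; the character then factors.\<close>
    also have "(\<Sum>v\<in>UNIV. A $ u $ v * \<psi> (v * b)) = (\<Sum>v\<in>(+) u ` S. \<psi> (v * b))"
      unfolding A_def by (rule sum.mono_neutral_cong_right) (auto simp: image_iff, metis add_diff_cancel_left' diff_add_cancel add.commute)
    also have "\<dots> = (\<Sum>x\<in>S. \<psi> (u * b) * \<psi> (b * x))"
      by (subst sum.reindex) (auto simp: algebra_simps simp flip: psi_add)
    also have "\<dots> = \<psi> (u * b) * lam b" by (simp add: lam_def sum_distrib_left)
    also have "[:0, 1:] * [:\<psi> (u * b):] - [:\<psi> (u * b) * lam b:] = [:\<psi> (u * b):] * [:- lam b, 1:]" by simp
    also have "\<dots> = (P ** D) $ u $ b"
      unfolding matrix_matrix_mult_def P_def D_def by (simp add: if_distrib[of "(*) _"] cong: if_cong)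
    finally show "(M ** P) $ u $ b = (P ** D) $ u $ b" .
  qed
  hence "det M * det P = det P * det D" by (metis det_mul)
  moreover have "det P \<noteq> 0"
  proof -
    have "(P ** Q) $ u $ v = (if u = v then [:of_nat CARD('a):] else 0)" for u v
    proof -
      have "(P ** Q) $ u $ v = [:\<Sum>b\<in>UNIV. \<psi> (u * b) * \<psi> (- (b * v)):]"
        unfolding matrix_matrix_mult_def P_def Q_def by (simp add: const_sum mult.commute)
      also have "(\<Sum>b\<in>UNIV. \<psi> (u * b) * \<psi> (- (b * v))) = (\<Sum>b\<in>UNIV. \<psi> ((u - v) * b))"
        by (simp add: algebra_simps flip: psi_add)
      finally show ?thesis by (simp add: sum_psi_mult)
    qed
    hence "det (P ** Q) = (\<Prod>i\<in>(UNIV :: 'a set). [:of_nat CARD('a):])"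
      by (subst det_diagonal) auto
    hence "det (P ** Q) \<noteq> 0" by simp
    thus ?thesis by (auto simp: det_mul)
  qed
  ultimately have "det M = det D" by simp
  also have "\<dots> = (\<Prod>b\<in>UNIV. [:- lam b, 1:])" unfolding D_def by (subst det_diagonal) auto
  finally have "proots (det M) = (\<Sum>b\<in>UNIV. {#lam b#})" by (simp add: proots_prod)
  thus ?thesis unfolding spectrum_mset_def charpoly_vec_def M_def A_def lam_def .
qed

end

section \<open>Multiplicative characters, Gauss sums and Jacobi sums\<close>

locale multiplicative_character =
  fixes \<theta> :: "'a::{finite,field} \<Rightarrow> complex"
  assumes theta_mult: "\<theta> (x * y) = \<theta> x * \<theta> y" and theta_0: "\<theta> 0 = 0" and theta_1: "\<theta> 1 = 1"
begin

lemma theta_power: "\<theta> (x ^ k) = \<theta> x ^ k"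
  by (induction k) (simp_all add: theta_1 theta_mult)

lemma norm_theta:
  assumes "x \<noteq> 0"
  shows "norm (\<theta> x) = 1"
proof -
  have "card {0, 1 :: 'a} \<le> CARD('a)" by (rule card_mono) auto
  hence "CARD('a) - 1 \<noteq> 0" by simp
  moreover have "\<theta> x ^ (CARD('a) - 1) = 1" using power_CARD_minus_1[OF assms] theta_1 theta_power[of x "CARD('a) - 1"] by simp
  hence "norm (\<theta> x) ^ (CARD('a) - 1) = 1" by (metis norm_one norm_power)
  ultimately show ?thesis by (metis norm_ge_zero power_eq_1_iff real_norm_def abs_of_nonneg)
qed

lemma sum_theta:
  assumes "g \<noteq> 0" "\<theta> g \<noteq> 1"
  shows "(\<Sum>x\<in>UNIV. \<theta> x) = 0"
proof -
  have "(\<Sum>x\<in>UNIV. \<theta> x) = (\<Sum>x\<in>UNIV. \<theta> (g * x))"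
    by (rule sum.reindex_bij_witness[of _ "\<lambda>y. g * y" "\<lambda>y. y / g"]) (use assms in auto)
  also have "\<dots> = \<theta> g * (\<Sum>x\<in>UNIV. \<theta> x)" by (simp add: theta_mult sum_distrib_left)
  finally show ?thesis using assms by simp
qed

lemma multiplicative_character_square: "multiplicative_character (\<lambda>x. (\<theta> x)\<^sup>2)"
  by standard (simp_all add: theta_mult theta_0 theta_1 power_mult_distrib)

end

locale character_pair = additive_character \<psi> + multiplicative_character \<theta>
  for \<psi> \<theta> :: "'a::{finite,field} \<Rightarrow> complex"
begin

text \<open>Expand the product as a double sum and substitute \<open>x = t * y\<close>: the values
  of \<open>\<theta>\<close> at \<open>y\<close> cancel, and summing over \<open>y\<close> first
  leaves only \<open>t = 1\<close>.\<close>

lemma norm_gauss_sum: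
  assumes g: "g \<noteq> 0" "\<theta> g \<noteq> 1"
  shows "(\<Sum>x\<in>UNIV. \<theta> x * \<psi> x) * cnj (\<Sum>x\<in>UNIV. \<theta> x * \<psi> x) = of_nat CARD('a)"
proof -
  have "(\<Sum>x\<in>UNIV. \<theta> x * \<psi> x) * cnj (\<Sum>x\<in>UNIV. \<theta> x * \<psi> x)
      = (\<Sum>y\<in>UNIV. \<Sum>x\<in>UNIV. \<theta> x * \<psi> x * (cnj (\<theta> y) * \<psi> (- y)))"
    by (simp add: cnj_psi sum_product) (rule sum.swap)
  also have "\<dots> = (\<Sum>y\<in>UNIV. if y = 0 then 0 else (\<Sum>t\<in>UNIV. \<theta> t * \<psi> ((t - 1) * y)))"
  proof (rule sum.cong)
    fix y :: 'a
    have "(\<Sum>x\<in>UNIV. \<theta> x * \<psi> x * (cnj (\<theta> y) * \<psi> (- y))) = (\<Sum>t\<in>UNIV. \<theta> t * \<psi> ((t - 1) * y))" if y: "y \<noteq> 0"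
    proof -
      have yy: "\<theta> y * cnj (\<theta> y) = 1" using norm_theta[OF y] by (simp add: complex_norm_square[symmetric])
      have "(\<Sum>x\<in>UNIV. \<theta> x * \<psi> x * (cnj (\<theta> y) * \<psi> (- y)))
          = (\<Sum>t\<in>UNIV. \<theta> (t * y) * \<psi> (t * y) * (cnj (\<theta> y) * \<psi> (- y)))"
        by (rule sum.reindex_bij_witness[of _ "\<lambda>t. t * y" "\<lambda>x. x / y"]) (use y in auto)
      also have "\<dots> = (\<Sum>t\<in>UNIV. \<theta> t * (\<theta> y * cnj (\<theta> y)) * (\<psi> (t * y) * \<psi> (- y)))"
        by (simp add: theta_mult mult_ac)
      finally show ?thesis by (simp add: yy algebra_simps flip: psi_add)
    qed
    thus "(\<Sum>x\<in>UNIV. \<theta> x * \<psi> x * (cnj (\<theta> y) * \<psi> (- y)))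
       = (if y = 0 then 0 else (\<Sum>t\<in>UNIV. \<theta> t * \<psi> ((t - 1) * y)))" by (auto simp: theta_0)
  qed simp
  \<comment> \<open>Extending the outer sum to \<open>y = 0\<close> costs only the sum of
    \<open>\<theta>\<close>, which vanishes by orthogonality.\<close>
  also have "\<dots> = (\<Sum>y\<in>UNIV. \<Sum>t\<in>UNIV. \<theta> t * \<psi> ((t - 1) * y)) - (\<Sum>t\<in>UNIV. \<theta> t)"
    by (simp add: sum.remove[of UNIV "0 :: 'a"] psi_0)
  also have "\<dots> = (\<Sum>t\<in>UNIV. \<theta> t * (\<Sum>y\<in>UNIV. \<psi> ((t - 1) * y)))"
    by (subst sum.swap) (simp add: sum_theta[OF g] sum_distrib_left)
  also have "\<dots> = (\<Sum>t::'a\<in>UNIV. if t = 1 then of_nat CARD('a) else 0)"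
    by (rule sum.cong) (auto simp: sum_psi_mult theta_1)
  finally show ?thesis by simp
qed

text \<open>The last factor is the Jacobi sum of \<open>\<theta>\<close> with itself. Group the
  pairs by \<open>s = x + y\<close>: for \<open>s \<noteq> 0\<close> scaling \<open>x\<close> by
  \<open>s\<close> extracts the square of \<open>\<theta> s\<close>, while for \<open>s = 0\<close>
  the inner sum vanishes because the square of \<open>\<theta>\<close> is nontrivial.\<close>

lemma gauss_sum_square:
  assumes g: "g \<noteq> 0" "(\<theta> g)\<^sup>2 \<noteq> 1"
  shows "(\<Sum>x\<in>UNIV. \<theta> x * \<psi> x)\<^sup>2 = (\<Sum>x\<in>UNIV. (\<theta> x)\<^sup>2 * \<psi> x) * (\<Sum>x\<in>UNIV. \<theta> (x * (1 - x)))"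
proof -
  interpret sq: multiplicative_character "\<lambda>x. (\<theta> x)\<^sup>2" by (rule multiplicative_character_square)
  have "(\<Sum>x\<in>UNIV. \<theta> x * \<psi> x)\<^sup>2 = (\<Sum>x\<in>UNIV. \<Sum>y\<in>UNIV. \<theta> (x * y) * \<psi> (x + y))"
    by (simp add: power2_eq_square sum_product theta_mult psi_add mult_ac)
  also have "\<dots> = (\<Sum>x\<in>UNIV. \<Sum>s\<in>UNIV. \<theta> (x * (s - x)) * \<psi> s)"
  proof (rule sum.cong)
    fix x
    show "(\<Sum>y\<in>UNIV. \<theta> (x * y) * \<psi> (x + y)) = (\<Sum>s\<in>UNIV. \<theta> (x * (s - x)) * \<psi> s)"
      by (rule sum.reindex_bij_witness[of _ "\<lambda>s. s - x" "\<lambda>y. x + y"]) auto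
  qed simp
  also have "\<dots> = (\<Sum>s\<in>UNIV. (\<Sum>x\<in>UNIV. \<theta> (x * (s - x))) * \<psi> s)"
    by (subst sum.swap) (simp add: sum_distrib_right)
  also have "\<dots> = (\<Sum>s\<in>UNIV. (\<theta> s)\<^sup>2 * \<psi> s * (\<Sum>x\<in>UNIV. \<theta> (x * (1 - x))))"
  proof (rule sum.cong)
    fix s :: 'a
    have "(\<Sum>x\<in>UNIV. \<theta> (x * (s - x))) = (\<theta> s)\<^sup>2 * (\<Sum>x\<in>UNIV. \<theta> (x * (1 - x)))"
    proof (cases "s = 0")
      case True
      have "(\<Sum>x\<in>UNIV. \<theta> (x * (s - x))) = \<theta> (- 1) * (\<Sum>x\<in>UNIV. (\<theta> x)\<^sup>2)"
        unfolding sum_distrib_left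
      proof (rule sum.cong)
        fix x
        have "x * (s - x) = (- 1) * (x * x)" using True by simp
        thus "\<theta> (x * (s - x)) = \<theta> (- 1) * (\<theta> x)\<^sup>2" by (simp only: theta_mult power2_eq_square)
      qed simp
      thus ?thesis using True sq.sum_theta[OF g] by (simp add: theta_0)
    next
      case False
      have "(\<Sum>x\<in>UNIV. \<theta> (x * (s - x))) = (\<Sum>x\<in>UNIV. \<theta> ((s * x) * (s - s * x)))"
        by (rule sum.reindex_bij_witness[of _ "\<lambda>x. s * x" "\<lambda>x. x / s"]) (use False in auto)
      also have "\<dots> = (\<Sum>x\<in>UNIV. (\<theta> s)\<^sup>2 * \<theta> (x * (1 - x)))"
      proof (rule sum.cong)
        fix x
        have "(s * x) * (s - s * x) = s * s * (x * (1 - x))" by (simp add: algebra_simps)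
        thus "\<theta> ((s * x) * (s - s * x)) = (\<theta> s)\<^sup>2 * \<theta> (x * (1 - x))" by (simp only: theta_mult power2_eq_square)
      qed simp
      finally show ?thesis by (simp add: sum_distrib_left)
    qed
    thus "(\<Sum>x\<in>UNIV. \<theta> (x * (s - x))) * \<psi> s = (\<theta> s)\<^sup>2 * \<psi> s * (\<Sum>x\<in>UNIV. \<theta> (x * (1 - x)))" by simp
  qed simp
  finally show ?thesis by (simp add: sum_distrib_right)
qed

end

section \<open>Quartic periods\<close>

text \<open>No generator is required of \<open>g\<close>: that \<open>g ^ n\<close> squares to
  \<open>- 1\<close> makes it a primitive fourth root of unity, so \<open>1, g, g^2, g^3\<close>
  represent the four cosets of \<open>R4\<close>. Divisibility of \<open>n\<close> by
  \<open>p - 1\<close> puts the units of the prime field into \<open>R4\<close>, and evenness of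
  \<open>n\<close> puts \<open>- 1\<close> there.\<close>

locale quartic_field = additive_character \<psi> for \<psi> :: "'a::{finite,field} \<Rightarrow> complex" +
  fixes p n :: nat and g :: 'a
  assumes p: "prime p" and CHAR: "CHAR('a) = p" and CARD: "CARD('a) = 4 * n + 1" and n_pos: "n > 0"
    and even_n: "even n" and dvd_n: "p - 1 dvd n" and g: "(g ^ n)\<^sup>2 = - 1"
begin

definition \<iota> :: 'a where "\<iota> = g ^ n"

lemma iota_square: "\<iota> * \<iota> = - 1"
  using g by (simp add: \<iota>_def power2_eq_square)

lemma two_neq_0: "(2 :: 'a) \<noteq> 0"
proof
  assume "(2 :: 'a) = 0"
  hence "of_nat 2 = (0 :: 'a)" by simp
  hence "p dvd 2" using CHAR by (simp only: of_nat_eq_0_iff_char_dvd)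
  hence "p = 2" using p by (simp add: primes_dvd_imp_eq)
  moreover have "p dvd 4 * n + 1" using CHAR_dvd_CARD[where ?'a = 'a] CHAR CARD by simp
  ultimately show False by (metis dvd_add_right_iff dvd_mult2 even_numeral odd_one)
qed

lemma one_neq_minus_one: "(1 :: 'a) \<noteq> - 1"
  using two_neq_0 by (metis add.right_inverse one_add_one)

lemma iota_distinct [simp]:
  "\<iota> \<noteq> 0" "\<iota> \<noteq> 1" "\<iota> \<noteq> - 1" "\<iota> \<noteq> - \<iota>" "1 \<noteq> \<iota>" "- 1 \<noteq> \<iota>" "- \<iota> \<noteq> \<iota>" "- \<iota> \<noteq> 1" "1 \<noteq> - \<iota>"
  "(1 :: 'a) \<noteq> - 1" "- 1 \<noteq> (1 :: 'a)"
proof -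
  show 0: "\<iota> \<noteq> 0" using iota_square by auto
  show 1: "\<iota> \<noteq> 1" using iota_square one_neq_minus_one by auto
  show 2: "\<iota> \<noteq> - 1" using iota_square one_neq_minus_one by auto
  show 3: "\<iota> \<noteq> - \<iota>" using 0 two_neq_0 by (metis add.right_inverse mult_2 mult_eq_0_iff)
  show "(1 :: 'a) \<noteq> - 1" by (rule one_neq_minus_one)
  show "1 \<noteq> \<iota>" "- 1 \<noteq> \<iota>" "- \<iota> \<noteq> \<iota>" "- 1 \<noteq> (1 :: 'a)" using 1 2 3 one_neq_minus_one by metis+
  show "- \<iota> \<noteq> 1" "1 \<noteq> - \<iota>" using 2 by (metis minus_minus)+
qed

lemma g_neq_0: "g \<noteq> 0"
  using iota_distinct(1) n_pos by (auto simp: \<iota>_def)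

text \<open>For \<open>x \<noteq> 0\<close> the power \<open>t = x ^ n\<close> satisfies
  \<open>t^4 = 1\<close>, and \<open>X^4 - 1\<close> splits over the roots
  \<open>1, - 1, \<iota>, - \<iota>\<close>.\<close>

lemma power_n_cases:
  obtains "x = 0" | "x \<noteq> 0" "x ^ n = 1" | "x \<noteq> 0" "x ^ n = \<iota>" | "x \<noteq> 0" "x ^ n = - 1" | "x \<noteq> 0" "x ^ n = - \<iota>"
proof (cases "x = 0")
  case False
  define t where "t = x ^ n"
  have "t ^ 4 = 1" using power_CARD_minus_1[OF False] CARD by (simp add: t_def mult.commute flip: power_mult)
  hence "(t - 1) * (t + 1) * ((t - \<iota>) * (t + \<iota>)) = 0"
    using iota_square by (simp add: algebra_simps power4_eq_xxxx)
  hence "t = 1 \<or> t = - 1 \<or> t = \<iota> \<or> t = - \<iota>" by (auto simp: eq_neg_iff_add_eq_0)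
  thus thesis using that False by (auto simp: t_def)
qed

lemma zero_power_n [simp]: "(0 :: 'a) ^ n = 0"
  using n_pos by simp

text \<open>Counting from both sides: \<open>X^n - 1\<close> has at most \<open>n\<close> roots,
  while the \<open>4 * n\<close> units fall into fibres of size at most 4 under the fourth power
  map, so \<open>R4\<close> has at least \<open>n\<close> elements.\<close>

lemma R4_eq: "(R4 :: 'a set) = {y. y ^ n = 1}" and card_R4: "card (R4 :: 'a set) = n"
proof -
  have sub: "(R4 :: 'a set) \<subseteq> {y. y ^ n = 1}"
    using power_CARD_minus_1[where ?'a = 'a] CARD by (auto simp: R4_def simp flip: power_mult)
  have le: "card {y :: 'a. y ^ n = 1} \<le> n" by (rule card_nth_roots_le[OF n_pos])
  have "UNIV - {0 :: 'a} \<subseteq> (\<Union>y\<in>R4. {x. x ^ 4 = y})" by (auto simp: R4_def)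
  hence "card (UNIV - {0 :: 'a}) \<le> card (\<Union>y\<in>(R4 :: 'a set). {x. x ^ 4 = y})" by (intro card_mono) auto
  also have "\<dots> \<le> (\<Sum>y\<in>(R4 :: 'a set). card {x. x ^ 4 = y})" by (rule card_UN_le) simp
  also have "\<dots> \<le> (\<Sum>y\<in>(R4 :: 'a set). 4)" by (intro sum_mono card_nth_roots_le) simp
  finally have ge: "n \<le> card (R4 :: 'a set)" using CARD by simp
  show *: "(R4 :: 'a set) = {y. y ^ n = 1}" using sub le ge by (intro card_seteq) auto
  show "card (R4 :: 'a set) = n" using le ge unfolding * by simp
qed

lemma R4_iff: "(x :: 'a) \<in> R4 \<longleftrightarrow> x ^ n = 1"
  by (simp add: R4_eq)

lemma R4_neq_0: "(x :: 'a) \<in> R4 \<Longrightarrow> x \<noteq> 0"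
  by (auto simp: R4_iff)

lemma R4_mult: "(x :: 'a) \<in> R4 \<Longrightarrow> y \<in> R4 \<Longrightarrow> x * y \<in> R4"
  by (simp add: R4_iff power_mult_distrib)

lemma R4_mult_right_iff: "(x :: 'a) \<in> R4 \<Longrightarrow> x * y \<in> R4 \<longleftrightarrow> y \<in> R4"
  by (simp add: R4_iff power_mult_distrib)

lemma of_nat_in_R4:
  assumes "0 < a" "a < p"
  shows "(of_nat a :: 'a) \<in> R4"
proof -
  have a0: "(of_nat a :: 'a) \<noteq> 0" using assms CHAR by (simp add: of_nat_eq_0_iff_char_dvd nat_dvd_not_less)
  have "(of_nat a :: 'a) ^ p = of_nat a" using of_nat_power_CHAR[where ?'a = 'a] CHAR by simp
  moreover have "(of_nat a :: 'a) ^ p = of_nat a ^ (p - 1) * of_nat a"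
    using power_minus_mult[of p "of_nat a :: 'a"] prime_gt_0_nat[OF p] by simp
  ultimately have "(of_nat a :: 'a) ^ (p - 1) = 1" using a0 by simp
  thus ?thesis using dvd_n by (auto simp: R4_iff power_mult elim!: dvdE)
qed

lemma sum_cosets:
  fixes f :: "'a \<Rightarrow> 'b::comm_monoid_add"
  shows "(\<Sum>x\<in>UNIV. f x) = f 0 + (\<Sum>x\<in>R4. f x) + (\<Sum>x\<in>R4. f (g * x)) + (\<Sum>x\<in>R4. f (g ^ 2 * x)) + (\<Sum>x\<in>R4. f (g ^ 3 * x))"
proof -
  define C where "C c = {x :: 'a. x ^ n = c}" for c
  have U: "UNIV = ({0} \<union> C 1 \<union> C \<iota> \<union> C (- 1)) \<union> C (- \<iota>)"
  proof (rule UNIV_eq_I)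
    fix x show "x \<in> ({0} \<union> C 1 \<union> C \<iota> \<union> C (- 1)) \<union> C (- \<iota>)" by (rule power_n_cases[of x]) (auto simp: C_def)
  qed
  have "(\<Sum>x\<in>UNIV. f x) = f 0 + sum f (C 1) + sum f (C \<iota>) + sum f (C (- 1)) + sum f (C (- \<iota>))"
    unfolding U by (subst sum.union_disjoint; auto simp: C_def add_ac)+
  \<comment> \<open>Multiplication by \<open>g ^ j\<close> carries \<open>R4\<close> bijectively
    onto the class where the \<open>n\<close>-th power is \<open>\<iota> ^ j\<close>.\<close>
  moreover have "sum f (C (\<iota> ^ j)) = (\<Sum>x\<in>R4. f (g ^ j * x))" for j
  proof -
    have gj: "(g ^ j) ^ n = \<iota> ^ j" unfolding \<iota>_def by (simp add: mult.commute flip: power_mult)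
    show ?thesis
      by (rule sum.reindex_bij_witness[of _ "\<lambda>x. g ^ j * x" "\<lambda>x. x / g ^ j"])
         (use g_neq_0 gj in \<open>auto simp: C_def R4_iff power_mult_distrib power_divide\<close>)
  qed
  from this[of 0] this[of 1] this[of 2] this[of 3]
  have "sum f (C 1) = (\<Sum>x\<in>R4. f x)" "sum f (C \<iota>) = (\<Sum>x\<in>R4. f (g * x))"
    "sum f (C (- 1)) = (\<Sum>x\<in>R4. f (g ^ 2 * x))" "sum f (C (- \<iota>)) = (\<Sum>x\<in>R4. f (g ^ 3 * x))"
    by (simp_all add: power2_eq_square power3_eq_cube iota_square)
  ultimately show ?thesis by simp
qed

text \<open>The quartic Gaussian period at \<open>b\<close>, which is the eigenvalue belonging to
  the character \<open>x \<mapsto> \<psi> (b * x)\<close>.\<close>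

definition \<eta> :: "'a \<Rightarrow> complex" where "\<eta> b = (\<Sum>x\<in>R4. \<psi> (b * x))"

lemma eta_0: "\<eta> 0 = of_nat n"
  by (simp add: \<eta>_def psi_0 card_R4)

lemma eta_mult_R4:
  assumes "r \<in> R4"
  shows "\<eta> (b * r) = \<eta> b"
  unfolding \<eta>_def
  by (rule sum.reindex_bij_witness[of _ "\<lambda>x. x / r" "\<lambda>x. r * x"])
     (use assms R4_neq_0[OF assms] in \<open>auto simp: R4_iff power_mult_distrib power_divide mult_ac\<close>)

lemma eta_cases:
  assumes "b \<noteq> 0"
  shows "\<eta> b = \<eta> 1 \<or> \<eta> b = \<eta> g \<or> \<eta> b = \<eta> (g ^ 2) \<or> \<eta> b = \<eta> (g ^ 3)"
proof -
  have coset: "\<eta> b = \<eta> (g ^ j)" if "b ^ n = \<iota> ^ j" for j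
  proof -
    have "(g ^ j) ^ n = \<iota> ^ j" unfolding \<iota>_def by (simp add: mult.commute flip: power_mult)
    hence "b / g ^ j \<in> R4" using that by (simp add: R4_iff power_divide)
    hence "\<eta> (g ^ j * (b / g ^ j)) = \<eta> (g ^ j)" by (rule eta_mult_R4)
    thus ?thesis using g_neq_0 by simp
  qed
  from coset[of 0] coset[of 1] coset[of 2] coset[of 3] assms show ?thesis
    by (rule_tac power_n_cases[of b]) (auto simp: power2_eq_square power3_eq_cube iota_square)
qed

lemma spectrum_gamma4:
  "spectrum_mset (gamma4_adj :: complex ^ 'a::{finite,field} ^ 'a::{finite,field}) =
    {#of_nat n#} + replicate_mset n (\<eta> 1) + replicate_mset n (\<eta> g)
      + replicate_mset n (\<eta> (g ^ 2)) + replicate_mset n (\<eta> (g ^ 3))"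
proof -
  have rep: "(\<Sum>x\<in>R4. {#\<eta> (b * x)#}) = replicate_mset n (\<eta> b)" for b
  proof -
    have "(\<Sum>x\<in>R4. {#\<eta> (b * x)#}) = (\<Sum>x\<in>(R4 :: 'a set). {#\<eta> b#})"
      by (rule sum.cong) (auto simp: eta_mult_R4)
    also have "\<dots> = replicate_mset (card (R4 :: 'a set)) (\<eta> b)"
      using finite[of "R4 :: 'a set"] by (induction rule: finite_induct) auto
    finally show ?thesis by (simp add: card_R4)
  qed
  have "spectrum_mset (gamma4_adj :: complex ^ 'a::{finite,field} ^ 'a::{finite,field}) = (\<Sum>b\<in>UNIV. {#\<eta> b#})"
    unfolding gamma4_adj_def gamma4_edge_def \<eta>_def by (rule spectrum_cayley)
  also have "\<dots> = {#\<eta> 0#} + (\<Sum>x\<in>R4. {#\<eta> (1 * x)#}) + (\<Sum>x\<in>R4. {#\<eta> (g * x)#})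
      + (\<Sum>x\<in>R4. {#\<eta> (g ^ 2 * x)#}) + (\<Sum>x\<in>R4. {#\<eta> (g ^ 3 * x)#})"
    by (subst sum_cosets) simp
  finally show ?thesis unfolding rep eta_0 .
qed

text \<open>Averaging over the units of the prime field gives \<open>(p - 1) * \<eta> b = p * card K - n\<close>, and \<open>K\<close> is a union of
  cosets of these units.\<close>

lemma eta_eq_of_int: "\<exists>h :: int. \<eta> b = of_int h"
proof -
  have p1: "p > 1" using p by (rule prime_gt_1_nat)
  define F where "F = (of_nat ` {1..<p} :: 'a set)"
  define K where "K = {x \<in> R4. \<psi> (b * x) = 1}"
  have inj: "inj_on (of_nat :: nat \<Rightarrow> 'a) {1..<p}"
    by (rule inj_onI) (auto simp: of_nat_eq_iff_cong_CHAR CHAR cong_def)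
  have FR: "F \<subseteq> R4" using of_nat_in_R4 by (auto simp: F_def)
  have cF: "card F = p - 1" unfolding F_def using inj by (simp add: card_image)
  have F1: "1 \<in> F" using p1 unfolding F_def by (auto intro!: image_eqI[of _ _ 1])
  have "(p - 1) * \<eta> b = (\<Sum>a\<in>{1..<p}. \<Sum>x\<in>R4. \<psi> (b * x) ^ a)"
  proof -
    have "(\<Sum>x\<in>R4. \<psi> (b * x) ^ a) = \<eta> b" if "a \<in> {1..<p}" for a
    proof -
      have "(of_nat a :: 'a) \<in> R4" using that of_nat_in_R4 by auto
      hence "\<eta> (b * of_nat a) = \<eta> b" by (rule eta_mult_R4)
      thus ?thesis unfolding \<eta>_def by (simp add: mult_ac flip: psi_of_nat_mult)
    qed
    thus ?thesis using p1 by (simp add: of_nat_diff)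
  qed
  \<comment> \<open>The powers \<open>z^1, ..., z^(p - 1)\<close> of a \<open>p\<close>-th root of
    unity \<open>z\<close> sum to \<open>p - 1\<close> if \<open>z = 1\<close> and to
    \<open>- 1\<close> otherwise.\<close>
  also have "\<dots> = (\<Sum>x\<in>R4. if \<psi> (b * x) = 1 then of_nat (p - 1) else - 1)"
  proof (subst sum.swap, rule sum.cong)
    fix x
    have z: "\<psi> (b * x) ^ p = 1" using psi_power_CHAR CHAR by simp
    have "{..<p} = insert 0 {1..<p}" using p1 by auto
    hence "(\<Sum>a\<in>{1..<p}. \<psi> (b * x) ^ a) = (\<Sum>a<p. \<psi> (b * x) ^ a) - 1" by simp
    thus "(\<Sum>a\<in>{1..<p}. \<psi> (b * x) ^ a) = (if \<psi> (b * x) = 1 then of_nat (p - 1) else - 1)"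
      using z p1 by (auto simp: sum_gp_strict of_nat_diff)
  qed simp
  also have "\<dots> = of_nat (p * card K) - of_nat n"
  proof -
    have "(\<Sum>x\<in>R4. if \<psi> (b * x) = 1 then of_nat (p - 1) else - 1)
        = (\<Sum>x\<in>R4. (if \<psi> (b * x) = 1 then of_nat p else 0) - (1 :: complex))"
      by (rule sum.cong) (use p1 in \<open>auto simp: of_nat_diff\<close>)
    also have "\<dots> = of_nat (card K) * of_nat p - of_nat n"
      unfolding sum_subtractf K_def by (simp add: card_R4 flip: sum.inter_filter)
    finally show ?thesis by simp
  qed
  finally have eq: "(p - 1) * \<eta> b = of_nat (p * card K) - of_nat n" .
  have KF: "a * x \<in> K" if "a \<in> F" "x \<in> K" for a x
  proof -
    obtain k where k: "a = of_nat k" using \<open>a \<in> F\<close> unfolding F_def by blast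
    have "\<psi> (b * (a * x)) = \<psi> (b * x) ^ k" by (simp add: k mult_ac flip: psi_of_nat_mult)
    thus ?thesis using that FR by (auto simp: K_def R4_mult)
  qed
  \<comment> \<open>The group \<open>F\<close> of units of the prime field acts on \<open>K\<close>
    by multiplication, freely since \<open>0\<close> is not in \<open>K\<close>; its orbits
    partition \<open>K\<close> into blocks of size \<open>p - 1\<close>.\<close>
  have "p - 1 dvd card K"
  proof -
    define C where "C = (\<lambda>x. (\<lambda>a. a * x) ` F) ` K"
    have "\<Union>C = K"
    proof (rule equalityI)
      show "\<Union>C \<subseteq> K" using KF by (auto simp: C_def)
      show "K \<subseteq> \<Union>C" using F1 by (force simp: C_def)
    qed
    moreover have "p - 1 dvd card (\<Union>C)"
    proof (rule dvd_partition)
      show "\<forall>c\<in>C. p - 1 dvd card c"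
      proof
        fix c assume "c \<in> C"
        then obtain x where x: "x \<in> K" "c = (\<lambda>a. a * x) ` F" unfolding C_def by blast
        have "x \<noteq> 0" using x R4_neq_0 by (auto simp: K_def)
        hence "inj_on (\<lambda>a. a * x) F" by (simp add: inj_on_def)
        thus "p - 1 dvd card c" by (simp add: x card_image cF)
      qed
      have mulF: "a * a' \<in> F" if "a \<in> F" "a' \<in> F" for a a'
      proof -
        obtain k k' where k: "a = of_nat k" "a' = of_nat k'" using \<open>a \<in> F\<close> \<open>a' \<in> F\<close> unfolding F_def by blast
        have "a * a' = of_nat ((k * k') mod p)" unfolding k of_nat_mult[symmetric] by (simp add: of_nat_eq_iff_cong_CHAR CHAR cong_def del: of_nat_mult)
        moreover have "a * a' \<noteq> 0" using that FR R4_neq_0 by auto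
        ultimately show ?thesis unfolding F_def using p1 by (intro image_eqI[of _ _ "(k * k') mod p"]) (auto intro!: Suc_leI gr0I)
      qed
      \<comment> \<open>Elements of \<open>F\<close> lie in \<open>R4\<close>, so
        \<open>a ^ n = 1\<close> and the inverse is a power of \<open>a\<close>.\<close>
      have divF: "inverse a \<in> F" if "a \<in> F" for a
      proof -
        have pw: "a ^ k \<in> F" for k by (induction k) (auto simp: F1 mulF that)
        have "a \<noteq> 0" using that FR R4_neq_0 by auto
        moreover have "a ^ (n - 1) * a = 1" using that FR power_minus_mult[OF n_pos, of a] R4_iff[of a] by auto
        ultimately have "inverse a = a ^ (n - 1)" by (metis inverse_unique mult.commute)
        thus ?thesis using pw by simp
      qed
      show "\<forall>c1\<in>C. \<forall>c2\<in>C. c1 \<noteq> c2 \<longrightarrow> c1 \<inter> c2 = {}"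
      proof (intro ballI impI)
        have sub: "(\<lambda>a. a * x) ` F \<subseteq> (\<lambda>a. a * y) ` F" if "a \<in> F" "a' \<in> F" "a * x = a' * y" for a a' x y
        proof safe
          fix d assume d: "d \<in> F"
          have a0: "a \<noteq> 0" using that FR R4_neq_0 by auto
          have "x = inverse a * (a' * y)" using a0 by (simp flip: that(3))
          hence "d * x = d * (inverse a * a') * y" by (simp add: mult_ac)
          moreover have "d * (inverse a * a') \<in> F" using d that by (intro mulF divF)
          ultimately show "d * x \<in> (\<lambda>a. a * y) ` F" by blast
        qed
        fix c1 c2 assume "c1 \<in> C" "c2 \<in> C" and ne: "c1 \<noteq> c2"
        then obtain x y where xy: "c1 = (\<lambda>a. a * x) ` F" "c2 = (\<lambda>a. a * y) ` F" unfolding C_def by blast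
        show "c1 \<inter> c2 = {}"
        proof (rule ccontr)
          assume "c1 \<inter> c2 \<noteq> {}"
          then obtain a a' where "a \<in> F" "a' \<in> F" "a * x = a' * y" unfolding xy by blast
          hence "c1 = c2" unfolding xy using sub[of a a' x y] sub[of a' a y x] by auto
          thus False using ne by simp
        qed
      qed
    qed simp
    ultimately show ?thesis by simp
  qed
  then obtain k where k: "card K = (p - 1) * k" by (elim dvdE)
  obtain l where l: "n = (p - 1) * l" using dvd_n by (elim dvdE)
  \<comment> \<open>Both \<open>card K\<close> and \<open>n\<close> are multiples of
    \<open>p - 1\<close>, so this factor cancels and leaves the integer
    \<open>p * k - l\<close>.\<close>
  have "of_nat (p - 1) * \<eta> b = of_nat (p - 1) * of_int (int (p * k) - int l)"
    using eq unfolding k l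
    by (simp only: of_nat_mult of_int_mult of_int_diff of_int_of_nat_eq right_diff_distrib mult_ac)
  hence "\<eta> b = of_int (int (p * k) - int l)" using p1 by simp
  thus ?thesis by blast
qed

end

section \<open>Quartic Gauss and Jacobi sums\<close>

context quartic_field
begin

text \<open>Real and imaginary part of the quartic character that takes the value
  \<open>\<i>\<close> at \<open>g\<close>. Keeping them as integers lets the same data be read in
  the complex numbers and, through \<open>of_int\<close>, in the finite field.\<close>

definition re\<^sub>4 :: "'a \<Rightarrow> int" where
  "re\<^sub>4 x = (if x ^ n = 1 then 1 else if x ^ n = - 1 then - 1 else 0)"

definition im\<^sub>4 :: "'a \<Rightarrow> int" where
  "im\<^sub>4 x = (if x ^ n = \<iota> then 1 else if x ^ n = - \<iota> then - 1 else 0)"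

definition \<theta> :: "'a \<Rightarrow> complex" where
  "\<theta> x = of_int (re\<^sub>4 x) + \<i> * of_int (im\<^sub>4 x)"

lemma theta_simps:
  "\<theta> 0 = 0" "x ^ n = 1 \<Longrightarrow> \<theta> x = 1" "x ^ n = \<iota> \<Longrightarrow> \<theta> x = \<i>" "x ^ n = - 1 \<Longrightarrow> \<theta> x = - 1" "x ^ n = - \<iota> \<Longrightarrow> \<theta> x = - \<i>"
  using iota_distinct(1) by (auto simp: \<theta>_def re\<^sub>4_def im\<^sub>4_def)

lemma theta_mult: "\<theta> (x * y) = \<theta> x * \<theta> y"
  by (rule power_n_cases[of x]; rule power_n_cases[of y])
     (simp_all add: theta_simps power_mult_distrib iota_square)

sublocale character_pair \<psi> \<theta>
  by standard (auto simp: theta_mult theta_simps)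

lemma theta_g: "\<theta> g = \<i>"
  by (rule theta_simps) (simp add: \<iota>_def)

text \<open>\<open>U + \<i> * V\<close> is the Jacobi sum of \<open>\<theta>\<close> with itself.\<close>

lemma eta_relations:
  obtains h\<^sub>0 h\<^sub>1 h\<^sub>2 h\<^sub>3 U V :: int where
    "\<eta> 1 = of_int h\<^sub>0" "\<eta> g = of_int h\<^sub>1" "\<eta> (g ^ 2) = of_int h\<^sub>2" "\<eta> (g ^ 3) = of_int h\<^sub>3"
    "h\<^sub>0 + h\<^sub>1 + h\<^sub>2 + h\<^sub>3 = - 1"
    "(h\<^sub>0 - h\<^sub>2)\<^sup>2 + (h\<^sub>1 - h\<^sub>3)\<^sup>2 = int CARD('a)"
    "(h\<^sub>0 - h\<^sub>1 + h\<^sub>2 - h\<^sub>3)\<^sup>2 = int CARD('a)"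
    "(h\<^sub>0 - h\<^sub>2)\<^sup>2 - (h\<^sub>1 - h\<^sub>3)\<^sup>2 = (h\<^sub>0 - h\<^sub>1 + h\<^sub>2 - h\<^sub>3) * U"
    "2 * (h\<^sub>0 - h\<^sub>2) * (h\<^sub>1 - h\<^sub>3) = (h\<^sub>0 - h\<^sub>1 + h\<^sub>2 - h\<^sub>3) * V"
    "U = (\<Sum>x\<in>UNIV. re\<^sub>4 (x * (1 - x)))" "V = (\<Sum>x\<in>UNIV. im\<^sub>4 (x * (1 - x)))"
proof -
  obtain h\<^sub>0 h\<^sub>1 h\<^sub>2 h\<^sub>3 :: int where h: "\<eta> 1 = of_int h\<^sub>0" "\<eta> g = of_int h\<^sub>1" "\<eta> (g ^ 2) = of_int h\<^sub>2" "\<eta> (g ^ 3) = of_int h\<^sub>3"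
    using eta_eq_of_int by metis
  define U V where UV: "U = (\<Sum>x\<in>UNIV. re\<^sub>4 (x * (1 - x)))" "V = (\<Sum>x\<in>UNIV. im\<^sub>4 (x * (1 - x)))"
  \<comment> \<open>The quartic character is constant on each coset of \<open>R4\<close>, so both
    Gauss sums become integer combinations of the periods with coefficients \<open>\<i> ^ j\<close>
    and \<open>(- 1) ^ j\<close>.\<close>
  have th: "\<theta> (g ^ j * x) = \<i> ^ j" if "x \<in> R4" for x j
    using that theta_simps(2)[of x] by (simp add: theta_mult theta_power theta_g R4_iff)
  have th': "x \<in> R4 \<Longrightarrow> \<theta> x = 1" "x \<in> R4 \<Longrightarrow> \<theta> (g * x) = \<i>" "x \<in> R4 \<Longrightarrow> \<theta> (g ^ 2 * x) = - 1" "x \<in> R4 \<Longrightarrow> \<theta> (g ^ 3 * x) = - \<i>" for x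
    using th[of x 0] th[of x 1] th[of x 2] th[of x 3] by (simp_all add: power3_eq_cube)
  have eta1: "(\<Sum>x\<in>R4. \<psi> x) = of_int h\<^sub>0" using h(1) by (simp add: \<eta>_def)
  note eta = eta1 h(2-4)[unfolded \<eta>_def]
  have s0: "1 + h\<^sub>0 + h\<^sub>1 + h\<^sub>2 + h\<^sub>3 = 0"
  proof -
    have "(1 :: complex) + of_int h\<^sub>0 + of_int h\<^sub>1 + of_int h\<^sub>2 + of_int h\<^sub>3 = 0"
      using sum_psi by (subst (asm) sum_cosets) (simp add: psi_0 eta)
    hence "of_int (1 + h\<^sub>0 + h\<^sub>1 + h\<^sub>2 + h\<^sub>3) = (0 :: complex)" by simp
    thus ?thesis by (simp only: of_int_eq_0_iff)
  qed
  have G1: "(\<Sum>x\<in>UNIV. \<theta> x * \<psi> x) = of_int (h\<^sub>0 - h\<^sub>2) + \<i> * of_int (h\<^sub>1 - h\<^sub>3)"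
  proof -
    have "(\<Sum>x\<in>R4. \<theta> x * \<psi> x) = (\<Sum>x\<in>R4. \<psi> x)" "(\<Sum>x\<in>R4. \<theta> (g * x) * \<psi> (g * x)) = (\<Sum>x\<in>R4. \<i> * \<psi> (g * x))"
      "(\<Sum>x\<in>R4. \<theta> (g ^ 2 * x) * \<psi> (g ^ 2 * x)) = (\<Sum>x\<in>R4. - \<psi> (g ^ 2 * x))"
      "(\<Sum>x\<in>R4. \<theta> (g ^ 3 * x) * \<psi> (g ^ 3 * x)) = (\<Sum>x\<in>R4. - (\<i> * \<psi> (g ^ 3 * x)))"
      by (rule sum.cong; simp add: th')+
    thus ?thesis by (subst sum_cosets) (simp add: eta theta_simps sum_negf right_diff_distrib flip: sum_distrib_left)
  qed
  have G2: "(\<Sum>x\<in>UNIV. (\<theta> x)\<^sup>2 * \<psi> x) = of_int (h\<^sub>0 - h\<^sub>1 + h\<^sub>2 - h\<^sub>3)"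
  proof -
    have "(\<Sum>x\<in>R4. (\<theta> x)\<^sup>2 * \<psi> x) = (\<Sum>x\<in>R4. \<psi> x)" "(\<Sum>x\<in>R4. (\<theta> (g * x))\<^sup>2 * \<psi> (g * x)) = (\<Sum>x\<in>R4. - \<psi> (g * x))"
      "(\<Sum>x\<in>R4. (\<theta> (g ^ 2 * x))\<^sup>2 * \<psi> (g ^ 2 * x)) = (\<Sum>x\<in>R4. \<psi> (g ^ 2 * x))"
      "(\<Sum>x\<in>R4. (\<theta> (g ^ 3 * x))\<^sup>2 * \<psi> (g ^ 3 * x)) = (\<Sum>x\<in>R4. - \<psi> (g ^ 3 * x))"
      by (rule sum.cong; simp add: th')+
    thus ?thesis by (subst sum_cosets) (simp add: eta theta_simps sum_negf)
  qed
  have J: "(\<Sum>x\<in>UNIV. \<theta> (x * (1 - x))) = of_int U + \<i> * of_int V"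
    by (simp add: \<theta>_def UV sum.distrib sum_distrib_left)
  have n1: "(h\<^sub>0 - h\<^sub>2)\<^sup>2 + (h\<^sub>1 - h\<^sub>3)\<^sup>2 = int CARD('a)"
  proof -
    have "of_int ((h\<^sub>0 - h\<^sub>2)\<^sup>2 + (h\<^sub>1 - h\<^sub>3)\<^sup>2) = (of_int (int CARD('a)) :: complex)"
      using norm_gauss_sum[OF g_neq_0] theta_g unfolding G1
      by (simp add: power2_eq_square algebra_simps)
    thus ?thesis by (simp only: of_int_eq_iff)
  qed
  have n2: "(h\<^sub>0 - h\<^sub>1 + h\<^sub>2 - h\<^sub>3)\<^sup>2 = int CARD('a)"
  proof -
    interpret sq: multiplicative_character "\<lambda>x. (\<theta> x)\<^sup>2" by (rule multiplicative_character_square)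
    interpret sq: character_pair \<psi> "\<lambda>x. (\<theta> x)\<^sup>2" ..
    have "of_int ((h\<^sub>0 - h\<^sub>1 + h\<^sub>2 - h\<^sub>3)\<^sup>2) = (of_int (int CARD('a)) :: complex)"
      using sq.norm_gauss_sum[OF g_neq_0] theta_g unfolding G2
      by (simp add: power2_eq_square)
    thus ?thesis by (simp only: of_int_eq_iff)
  qed
  have "(of_int (h\<^sub>0 - h\<^sub>2) + \<i> * of_int (h\<^sub>1 - h\<^sub>3))\<^sup>2 = of_int (h\<^sub>0 - h\<^sub>1 + h\<^sub>2 - h\<^sub>3) * (of_int U + \<i> * of_int V)"
    using gauss_sum_square[OF g_neq_0] theta_g unfolding G1 G2 J by simp
  hence "of_int ((h\<^sub>0 - h\<^sub>2)\<^sup>2 - (h\<^sub>1 - h\<^sub>3)\<^sup>2) = (of_int ((h\<^sub>0 - h\<^sub>1 + h\<^sub>2 - h\<^sub>3) * U) :: real)"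
    "of_int (2 * (h\<^sub>0 - h\<^sub>2) * (h\<^sub>1 - h\<^sub>3)) = (of_int ((h\<^sub>0 - h\<^sub>1 + h\<^sub>2 - h\<^sub>3) * V) :: real)"
    unfolding complex_eq_iff by (auto simp: power2_eq_square algebra_simps)
  hence "(h\<^sub>0 - h\<^sub>2)\<^sup>2 - (h\<^sub>1 - h\<^sub>3)\<^sup>2 = (h\<^sub>0 - h\<^sub>1 + h\<^sub>2 - h\<^sub>3) * U"
    "2 * (h\<^sub>0 - h\<^sub>2) * (h\<^sub>1 - h\<^sub>3) = (h\<^sub>0 - h\<^sub>1 + h\<^sub>2 - h\<^sub>3) * V" by (simp_all only: of_int_eq_iff)
  thus thesis using that[OF h] s0 n1 n2 UV by simp
qed

text \<open>The homomorphism from the Gaussian integers that sends \<open>\<i>\<close> to \<open>- \<iota>\<close> maps \<open>\<theta> x\<close> to \<open>x ^ (3 * n)\<close>, so the Jacobi sum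
  becomes a power sum in which only the \<open>n\<close>-th binomial term survives.\<close>

lemma jacobi_sum_not_dvd:
  assumes "p mod 4 = 1" "CARD('a) = p ^ m"
  shows "\<not> (int p dvd (\<Sum>x\<in>UNIV. re\<^sub>4 (x * (1 - x))) \<and> int p dvd (\<Sum>x\<in>UNIV. im\<^sub>4 (x * (1 - x))))"
proof
  assume dv: "int p dvd (\<Sum>x\<in>UNIV. re\<^sub>4 (x * (1 - x))) \<and> int p dvd (\<Sum>x\<in>UNIV. im\<^sub>4 (x * (1 - x)))"
  have dvd0: "of_int k = (0 :: 'a)" if "int p dvd k" for k
    using that CHAR by (simp add: of_int_eq_0_iff_char_dvd)
  \<comment> \<open>On the class with \<open>x ^ n = \<iota>\<close>, where the character is
    \<open>\<i>\<close>, the cube is \<open>- \<iota>\<close>: this is the reduction sending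
    \<open>\<i>\<close> to \<open>- \<iota>\<close>.\<close>
  have "(x ^ n) ^ 3 = of_int (re\<^sub>4 x) - of_int (im\<^sub>4 x) * \<iota>" for x
    using iota_distinct(1)
    by (rule_tac power_n_cases[of x]) (auto simp: re\<^sub>4_def im\<^sub>4_def power3_eq_cube iota_square)
  hence cube: "x ^ (3 * n) = of_int (re\<^sub>4 x) - of_int (im\<^sub>4 x) * \<iota>" for x
    by (simp add: mult.commute flip: power_mult)
  have "(\<Sum>x\<in>UNIV. (x * (1 - x)) ^ (3 * n))
      = of_int (\<Sum>x\<in>UNIV. re\<^sub>4 (x * (1 - x))) - of_int (\<Sum>x\<in>UNIV. im\<^sub>4 (x * (1 - x))) * \<iota>"
    unfolding cube by (simp add: sum_subtractf sum_distrib_right)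
  hence zero: "(\<Sum>x\<in>UNIV. (x * (1 - x :: 'a)) ^ (3 * n)) = 0" using dvd0[OF conjunct1[OF dv]] dvd0[OF conjunct2[OF dv]] by simp
  \<comment> \<open>The exponents run from \<open>3 * n\<close> to \<open>6 * n\<close>, and
    \<open>4 * n = q - 1\<close> is the only multiple of \<open>q - 1\<close> among them; it occurs
    at \<open>j = n\<close>. Larger exponents are first lowered with
    \<open>x ^ q = x\<close>.\<close>
  have ps: "(\<Sum>x\<in>UNIV. x ^ (3 * n + j)) = (if j = n then - 1 else (0 :: 'a))" if "j \<le> 3 * n" for j
  proof -
    consider "j < n" | "j = n" | "j > n" by linarith
    thus ?thesis
    proof cases
      case 1
      thus ?thesis using sum_UNIV_power_eq_0[of "3 * n + j", where ?'a = 'a] CARD n_pos by simp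
    next
      case 2
      thus ?thesis using sum_UNIV_power_CARD_minus_1[where ?'a = 'a] CARD by simp
    next
      case 3
      have "x ^ (3 * n + j) = x ^ (j - n)" for x :: 'a
      proof -
        have "3 * n + j = (4 * n + 1) + (j - n - 1)" "j - n = 1 + (j - n - 1)" using 3 by auto
        thus ?thesis using power_CARD[of x] CARD by (metis power_add power_one_right)
      qed
      thus ?thesis using sum_UNIV_power_eq_0[of "j - n", where ?'a = 'a] CARD 3 that by simp
    qed
  qed
  have "(\<Sum>x\<in>UNIV. (x * (1 - x :: 'a)) ^ (3 * n))
      = (\<Sum>x\<in>UNIV. \<Sum>j\<le>3 * n. of_nat (3 * n choose j) * (- 1) ^ j * x ^ (3 * n + j))"
  proof (rule sum.cong)
    fix x :: 'a
    have "(1 - x) ^ (3 * n) = (\<Sum>j\<le>3 * n. of_nat (3 * n choose j) * (- x) ^ j * 1 ^ (3 * n - j))"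
      by (subst binomial_ring[symmetric]) simp
    hence "(x * (1 - x)) ^ (3 * n) = x ^ (3 * n) * (\<Sum>j\<le>3 * n. of_nat (3 * n choose j) * (- x) ^ j)"
      by (simp add: power_mult_distrib)
    also have "\<dots> = (\<Sum>j\<le>3 * n. of_nat (3 * n choose j) * (- 1) ^ j * x ^ (3 * n + j))"
      unfolding sum_distrib_left by (rule sum.cong) (auto simp: power_add power_minus[of x] mult_ac)
    finally show "(x * (1 - x)) ^ (3 * n) = (\<Sum>j\<le>3 * n. of_nat (3 * n choose j) * (- 1) ^ j * x ^ (3 * n + j))" .
  qed simp
  also have "\<dots> = (\<Sum>j\<le>3 * n. of_nat (3 * n choose j) * (- 1) ^ j * (\<Sum>x\<in>UNIV. x ^ (3 * n + j)))"
    by (subst sum.swap) (simp add: sum_distrib_left)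
  also have "\<dots> = (\<Sum>j\<le>3 * n. if j = n then - (of_nat (3 * n choose n) * (- 1) ^ n) else 0)"
    by (rule sum.cong) (auto simp: ps)
  also have "\<dots> = - (of_nat (3 * n choose n) * (- 1) ^ n)" by simp
  finally have "of_nat (3 * n choose n) = (0 :: 'a)" using zero by simp
  hence "p dvd (3 * n choose n)" using CHAR by (simp add: of_nat_eq_0_iff_char_dvd)
  thus False using not_dvd_binomial_quarter[OF p assms(1), of n m] assms(2) CARD by simp
qed

end

section \<open>Connectedness and strong regularity\<close>

context quartic_field
begin

lemma minus_one_in_R4: "(- 1 :: 'a) \<in> R4"
  using even_n by (simp add: R4_iff)

lemma one_in_R4: "(1 :: 'a) \<in> R4"
  by (simp add: R4_iff)

lemma minus_in_R4_iff: "- (x :: 'a) \<in> R4 \<longleftrightarrow> x \<in> R4"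
  using R4_mult_right_iff[OF minus_one_in_R4, of x] by simp

text \<open>Translations and multiplications by elements of \<open>R4\<close> preserve edges, so the
  set \<open>K\<close> of vertices reachable from \<open>0\<close> is closed under the field
  operations. The bound \<open>n > 2\<close> makes \<open>(n + 1)^2\<close> exceed
  \<open>q = 4 * n + 1\<close>.\<close>

lemma gamma4_connected:
  assumes "n > 2"
  shows "digraph_connected (gamma4_edge :: 'a \<Rightarrow> 'a \<Rightarrow> bool)"
proof -
  let ?E = "gamma4_edge :: 'a \<Rightarrow> 'a \<Rightarrow> bool"
  define K where "K = {v. ?E\<^sup>*\<^sup>* 0 v}"
  have trans: "?E\<^sup>*\<^sup>* (w + u) (w + v)" if "?E\<^sup>*\<^sup>* u v" for u v w
    using that by (induction rule: rtranclp_induct)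
      (auto intro: rtranclp.rtrancl_into_rtrancl simp: gamma4_edge_def)
  have scale: "?E\<^sup>*\<^sup>* (r * u) (r * v)" if "?E\<^sup>*\<^sup>* u v" "r \<in> R4" for u v r
    using that(1)
  proof (induction rule: rtranclp_induct)
    case (step y z)
    have "r * z - r * y \<in> R4" using step(2) R4_mult[OF that(2)] by (simp add: gamma4_edge_def flip: right_diff_distrib)
    hence "?E (r * y) (r * z)" by (simp add: gamma4_edge_def)
    with step(3) show ?case by (rule rtranclp.rtrancl_into_rtrancl)
  qed simp
  have K0: "0 \<in> K" by (simp add: K_def)
  have Kadd: "x + y \<in> K" if "x \<in> K" "y \<in> K" for x y
    using that trans[of 0 y x] by (auto simp: K_def intro: rtranclp_trans)
  have KR: "r * x \<in> K" if "x \<in> K" "r \<in> R4" for x r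
    using that scale[of 0 x r] by (simp add: K_def)
  have R4K: "R4 \<subseteq> K" by (auto simp: K_def gamma4_edge_def)
  \<comment> \<open>Induction along a walk from \<open>0\<close> to \<open>y\<close>: each step
    changes the second factor by an element of \<open>R4\<close>, and \<open>K\<close> is closed
    under multiplication by \<open>R4\<close>.\<close>
  have Kmult: "x * y \<in> K" if "x \<in> K" "y \<in> K" for x y
  proof -
    have "?E\<^sup>*\<^sup>* 0 y" using that by (simp add: K_def)
    thus ?thesis
    proof (induction rule: rtranclp_induct)
      case (step y z)
      have "x * z = x * y + (z - y) * x" by (simp add: algebra_simps)
      thus ?case using step KR[OF that(1)] by (auto intro!: Kadd simp: gamma4_edge_def)
    qed (simp add: K0)
  qed
  have Kuminus: "- x \<in> K" if "x \<in> K" for x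
    using KR[OF that minus_one_in_R4] by simp
  have Kinv: "inverse x \<in> K" if "x \<in> K" "x \<noteq> 0" for x
  proof -
    have pw: "x ^ k \<in> K" for k
      by (induction k) (use R4K one_in_R4 that Kmult in auto)
    have "x ^ (4 * n - 1) * x = 1" using power_CARD_minus_1[OF that(2)] CARD n_pos power_minus_mult[of "4 * n" x] by simp
    hence "inverse x = x ^ (4 * n - 1)" by (metis inverse_unique mult.commute)
    thus ?thesis using pw by simp
  qed
  \<comment> \<open>\<open>K\<close> is a subfield with at least \<open>n + 1\<close> elements, and a proper subfield has at most \<open>sqrt q\<close> elements.\<close>
  have "K = UNIV"
  proof (rule ccontr)
    assume "K \<noteq> UNIV"
    then obtain y where y: "y \<notin> K" by blast
    \<comment> \<open>An element \<open>y\<close> outside the subfield \<open>K\<close> is linearly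
      independent of 1 over \<open>K\<close>.\<close>
    have "inj_on (\<lambda>(a, b). a + y * b) (K \<times> K)"
    proof (rule inj_onI, clarify)
      fix a b a' b' assume K: "a \<in> K" "b \<in> K" "a' \<in> K" "b' \<in> K" and eq: "a + y * b = a' + y * b'"
      have *: "y * (b - b') = a' - a" using eq by (simp add: algebra_simps)
      have "b = b'"
      proof (rule ccontr)
        assume "b \<noteq> b'"
        hence "y = (a' + - a) * inverse (b + - b')" using * by (simp add: field_simps)
        also have "\<dots> \<in> K" using K \<open>b \<noteq> b'\<close> by (intro Kmult Kadd Kinv Kuminus) auto
        finally show False using y by simp
      qed
      thus "a = a' \<and> b = b'" using * by simp
    qed
    hence "card (K \<times> K) \<le> CARD('a)" by (metis card_image card_mono finite subset_UNIV)
    moreover have "card (insert 0 (R4 :: 'a set)) \<le> card K" using K0 R4K by (intro card_mono) auto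
    hence "n + 1 \<le> card K" using card_R4 R4_neq_0 by (subst (asm) card_insert_disjoint) auto
    hence "(n + 1) * (n + 1) \<le> card (K \<times> K)" unfolding card_cartesian_product by (intro mult_le_mono)
    ultimately have "(n + 1) * (n + 1) \<le> 4 * n + 1" using CARD by linarith
    moreover have "(n + 1) * (n + 1) = n * n + 2 * n + 1" by simp
    moreover have "3 * n \<le> n * n" using assms by (intro mult_le_mono1) simp
    ultimately show False using n_pos by linarith
  qed
  hence "?E\<^sup>*\<^sup>* u v" for u v using trans[of 0 "v - u" u] by (auto simp: K_def)
  thus ?thesis by (simp add: digraph_connected_def)
qed

text \<open>The Fourier transform of the common neighbour count \<open>d \<mapsto> |R\<^sub>4 \<inter> (R\<^sub>4 + d)|\<close> is \<open>\<eta>\<^sup>2\<close>, which off zero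
  is an affine function of \<open>\<eta>\<close>, the transform of the indicator of \<open>R\<^sub>4\<close>.\<close>

lemma gamma4_strongly_regular:
  assumes two: "\<And>b. b \<noteq> 0 \<Longrightarrow> \<eta> b = \<alpha> \<or> \<eta> b = \<beta>"
  shows "strongly_regular (gamma4_edge :: 'a \<Rightarrow> 'a \<Rightarrow> bool)"
proof -
  define f :: "'a \<Rightarrow> complex" where "f x = (if x \<in> R4 then 1 else 0)" for x
  define c where "c d = card {x :: 'a. x \<in> R4 \<and> x - d \<in> R4}" for d
  have f_hat: "(\<Sum>x\<in>UNIV. f x * \<psi> (b * x)) = \<eta> b" for b
    unfolding f_def \<eta>_def by (rule sum.mono_neutral_cong_right) auto
  \<comment> \<open>Because \<open>- 1\<close> lies in \<open>R4\<close>, \<open>x - d\<close> may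
    be replaced by \<open>d - x\<close>, which turns the count into a convolution.\<close>
  have c_eq: "of_nat (c d) = (\<Sum>x\<in>UNIV. f x * f (d - x))" for d
  proof -
    have "(\<Sum>x\<in>UNIV. f x * f (d - x)) = (\<Sum>x\<in>{x. x \<in> R4 \<and> x - d \<in> R4}. 1)"
      by (rule sum.mono_neutral_cong_right) (use minus_in_R4_iff in \<open>force simp: f_def\<close>)+
    thus ?thesis by (simp add: c_def)
  qed
  have c_hat: "(\<Sum>d\<in>UNIV. of_nat (c d) * \<psi> (b * d)) = \<eta> b * \<eta> b" for b
  proof -
    have "(\<Sum>d\<in>UNIV. of_nat (c d) * \<psi> (b * d)) = (\<Sum>x\<in>UNIV. \<Sum>d\<in>UNIV. f x * f (d - x) * \<psi> (b * d))"
      unfolding c_eq by (subst sum.swap) (simp add: sum_distrib_right)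
    also have "\<dots> = (\<Sum>x\<in>UNIV. \<Sum>y\<in>UNIV. f x * f y * \<psi> (b * (x + y)))"
    proof (rule sum.cong)
      fix x
      show "(\<Sum>d\<in>UNIV. f x * f (d - x) * \<psi> (b * d)) = (\<Sum>y\<in>UNIV. f x * f y * \<psi> (b * (x + y)))"
        by (rule sum.reindex_bij_witness[of _ "\<lambda>y. x + y" "\<lambda>d. d - x"]) auto
    qed simp
    also have "\<dots> = (\<Sum>x\<in>UNIV. f x * \<psi> (b * x)) * (\<Sum>y\<in>UNIV. f y * \<psi> (b * y))"
      by (simp add: sum_product ring_distribs psi_add mult_ac)
    finally show ?thesis by (simp add: f_hat)
  qed
  \<comment> \<open>Chosen so that the transform of \<open>F\<close> at \<open>b \<noteq> 0\<close>
    is \<open>(\<eta> b - \<alpha>) * (\<eta> b - \<beta>)\<close>: the point mass at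
    \<open>0\<close> supplies the constant term.\<close>
  define F where "F d = of_nat (c d) - (\<alpha> + \<beta>) * f d + (if d = 0 then \<alpha> * \<beta> else 0)" for d
  have "F d = F d'" for d d'
  proof (rule constant_if_fourier_vanishes)
    fix b :: 'a assume b: "b \<noteq> 0"
    have "(\<Sum>x\<in>UNIV. F x * \<psi> (b * x)) = (\<Sum>x\<in>UNIV. of_nat (c x) * \<psi> (b * x)) - (\<alpha> + \<beta>) * (\<Sum>x\<in>UNIV. f x * \<psi> (b * x))
        + (\<Sum>x::'a\<in>UNIV. if x = 0 then \<alpha> * \<beta> else 0)"
      unfolding F_def sum_distrib_left sum_subtractf[symmetric] sum.distrib[symmetric]
      by (rule sum.cong) (auto simp: algebra_simps psi_0)
    also have "\<dots> = (\<eta> b - \<alpha>) * (\<eta> b - \<beta>)" unfolding c_hat f_hat by (simp add: algebra_simps)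
    finally show "(\<Sum>x\<in>UNIV. F x * \<psi> (b * x)) = 0" using two[OF b] by auto
  qed
  note F_const = this
  have c_const: "c d = c d'" if "d \<noteq> 0" "d' \<noteq> 0" "d \<in> R4 \<longleftrightarrow> d' \<in> R4" for d d'
  proof -
    have "(of_nat (c d) :: complex) = of_nat (c d')"
      using F_const[of d d'] that by (simp add: F_def f_def)
    thus ?thesis by simp
  qed
  have nbr: "card {w. gamma4_edge u w \<and> gamma4_edge v w} = c (v - u)" for u v :: 'a
    unfolding c_def gamma4_edge_def
    by (rule bij_betw_same_card[of "\<lambda>w. w - u"], rule bij_betwI[of _ _ _ "\<lambda>x. x + u"])
       (auto simp: algebra_simps)
  have deg: "card {w. gamma4_edge u w} = n" for u :: 'a
  proof -
    have "card {w. gamma4_edge u w} = card (R4 :: 'a set)"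
      unfolding gamma4_edge_def
      by (rule bij_betw_same_card[of "\<lambda>w. w - u"], rule bij_betwI[of _ _ _ "\<lambda>x. x + u"]) auto
    thus ?thesis by (simp add: card_R4)
  qed
  \<comment> \<open>Since \<open>c d\<close> depends for \<open>d \<noteq> 0\<close> only on whether
    \<open>d\<close> lies in \<open>R4\<close>, the elements \<open>1\<close> and \<open>g\<close>
    represent the adjacent and the non-adjacent case.\<close>
  have gR: "g \<notin> R4" using iota_distinct(2) by (simp add: R4_iff \<iota>_def)
  have sym: "gamma4_edge u v \<longleftrightarrow> gamma4_edge v u" for u v :: 'a
    using minus_in_R4_iff[of "v - u"] by (simp add: gamma4_edge_def)
  have irr: "\<not> gamma4_edge u u" for u :: 'a by (auto simp: gamma4_edge_def dest: R4_neq_0)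
  show ?thesis unfolding strongly_regular_def
  proof (intro conjI exI allI impI)
    fix u v :: 'a
    show "card {w. gamma4_edge u w} = n" by (rule deg)
    show "card {w. gamma4_edge u w \<and> gamma4_edge v w} = c 1" if "gamma4_edge u v"
      unfolding nbr using that R4_neq_0[of "v - u"] one_in_R4 by (intro c_const) (auto simp: gamma4_edge_def)
    show "card {w. gamma4_edge u w \<and> gamma4_edge v w} = c g" if "u \<noteq> v" "\<not> gamma4_edge u v"
      unfolding nbr using that gR g_neq_0 by (intro c_const) (auto simp: gamma4_edge_def)
  qed (use sym irr in auto)
qed

end

section \<open>The spectrum\<close>

text \<open>As \<open>P^2\<close> is 1 modulo 4, the congruence ties the sign of \<open>G\<close> to
  the parity of \<open>a\<close>; \<open>a\<close> and \<open>b\<close> have opposite parity because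
  their squares add up to an odd number.\<close>

lemma quartic_period_parity:
  fixes P G a b :: int
  assumes "odd P" "a\<^sup>2 + b\<^sup>2 = P\<^sup>2" "G\<^sup>2 = (P\<^sup>2)\<^sup>2" "4 dvd G + 2 * (P * a) - 1"
  shows "G = P\<^sup>2 \<and> even a \<and> odd b \<or> G = - (P\<^sup>2) \<and> odd a \<and> even b"
proof -
  obtain k where k: "P = 2 * k + 1" using assms(1) by (elim oddE)
  define l where "l = k\<^sup>2 + k"
  have P2: "P\<^sup>2 = 4 * l + 1" unfolding k l_def by (simp add: power2_eq_square algebra_simps)
  have par: "odd a \<longleftrightarrow> even b"
  proof -
    have "odd (a\<^sup>2 + b\<^sup>2)" using assms(1,2) by simp
    thus ?thesis by auto
  qed
  define w where "w = P * a"
  have odd_w: "even w \<longleftrightarrow> even a" using assms(1) by (simp add: w_def)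
  from assms(3) consider "G = P\<^sup>2" | "G = - (P\<^sup>2)" using power2_eq_iff by blast
  thus ?thesis
  proof cases
    case 1
    have "4 dvd 4 * l + 2 * w" using assms(4) unfolding 1 P2 w_def[symmetric] by simp
    hence "even w" by presburger
    thus ?thesis using 1 odd_w par by simp
  next
    case 2
    have "4 dvd - (4 * l) + 2 * w - 2" using assms(4) unfolding 2 P2 w_def[symmetric] by simp
    hence "odd w" by presburger
    thus ?thesis using 2 odd_w par by simp
  qed
qed

text \<open>The two periods whose difference vanishes share the value \<open>D\<close> of
  \<open>4 h + 1\<close>, where \<open>D\<close> is the quadratic Gauss sum up to sign. The other
  two differ by \<open>r\<close> up to sign, so one equals \<open>D\<close> as well, and the last is
  \<open>- 3 * D\<close> since the four values add up to 0.\<close>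

lemma semiprimitive_periods:
  fixes r h\<^sub>0 h\<^sub>1 h\<^sub>2 h\<^sub>3 :: int
  assumes "h\<^sub>0 + h\<^sub>1 + h\<^sub>2 + h\<^sub>3 = - 1"
    and "(h\<^sub>0 - h\<^sub>2)\<^sup>2 + (h\<^sub>1 - h\<^sub>3)\<^sup>2 = r\<^sup>2" "(h\<^sub>0 - h\<^sub>1 + h\<^sub>2 - h\<^sub>3)\<^sup>2 = r\<^sup>2"
    and "h\<^sub>0 - h\<^sub>2 = 0 \<or> h\<^sub>1 - h\<^sub>3 = 0"
  obtains D where "D = r \<or> D = - r" "4 dvd D - 1"
    "4 * h\<^sub>0 + 1 = - 3 * D \<and> 4 * h\<^sub>1 + 1 = D \<and> 4 * h\<^sub>2 + 1 = D \<and> 4 * h\<^sub>3 + 1 = D \<or>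
     4 * h\<^sub>0 + 1 = D \<and> 4 * h\<^sub>1 + 1 = - 3 * D \<and> 4 * h\<^sub>2 + 1 = D \<and> 4 * h\<^sub>3 + 1 = D \<or>
     4 * h\<^sub>0 + 1 = D \<and> 4 * h\<^sub>1 + 1 = D \<and> 4 * h\<^sub>2 + 1 = - 3 * D \<and> 4 * h\<^sub>3 + 1 = D \<or>
     4 * h\<^sub>0 + 1 = D \<and> 4 * h\<^sub>1 + 1 = D \<and> 4 * h\<^sub>2 + 1 = D \<and> 4 * h\<^sub>3 + 1 = - 3 * D"
proof -
  have G: "h\<^sub>0 - h\<^sub>1 + h\<^sub>2 - h\<^sub>3 = r \<or> h\<^sub>0 - h\<^sub>1 + h\<^sub>2 - h\<^sub>3 = - r" using assms(3) power2_eq_iff by blast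
  from assms(4) show thesis
  proof
    assume A: "h\<^sub>0 - h\<^sub>2 = 0"
    hence "(h\<^sub>1 - h\<^sub>3)\<^sup>2 = r\<^sup>2" using assms(2) by simp
    hence "h\<^sub>1 - h\<^sub>3 = r \<or> h\<^sub>1 - h\<^sub>3 = - r" using power2_eq_iff by blast
    moreover have "4 * h\<^sub>0 + 1 = h\<^sub>0 - h\<^sub>1 + h\<^sub>2 - h\<^sub>3" using assms(1) A by linarith
    ultimately show thesis using that[of "4 * h\<^sub>0 + 1"] G assms(1) A by (elim disjE) auto
  next
    assume B: "h\<^sub>1 - h\<^sub>3 = 0"
    hence "(h\<^sub>0 - h\<^sub>2)\<^sup>2 = r\<^sup>2" using assms(2) by simp
    hence "h\<^sub>0 - h\<^sub>2 = r \<or> h\<^sub>0 - h\<^sub>2 = - r" using power2_eq_iff by blast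
    moreover have "4 * h\<^sub>1 + 1 = - (h\<^sub>0 - h\<^sub>1 + h\<^sub>2 - h\<^sub>3)" using assms(1) B by linarith
    ultimately show thesis using that[of "4 * h\<^sub>1 + 1"] G assms(1) B by (elim disjE) auto
  qed
qed

text \<open>The quotient is \<open>1 + p + ... + p^(m - 1)\<close>. It is congruent to
  \<open>m\<close> modulo any \<open>d\<close> with \<open>p\<close> congruent to 1 modulo
  \<open>d\<close>; this is used for \<open>d = 2\<close> and \<open>d = 4\<close>.\<close>

lemma geometric_sum_mod_4:
  fixes p m :: nat
  assumes "prime p" "4 dvd (p ^ m - 1) div (p - 1)" "m > 0"
  shows "p - 1 dvd (p ^ m - 1) div 4" "4 dvd p ^ m - 1" "odd p" "even m" "p mod 4 = 1 \<Longrightarrow> 4 dvd m"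
proof -
  define s where "s = (\<Sum>i<m. p ^ i)"
  have p1: "p > 1" using assms(1) by (rule prime_gt_1_nat)
  have "int p ^ m - 1 = (int p - 1) * (\<Sum>i<m. int p ^ i)" by (rule power_diff_1_eq)
  hence "int (p ^ m - 1) = int ((p - 1) * s)" using p1 by (simp add: s_def of_nat_diff)
  hence ps: "p ^ m - 1 = (p - 1) * s" by (simp only: of_nat_eq_iff)
  hence s4: "4 dvd s" using assms(2) p1 by simp
  then obtain k where k: "s = 4 * k" by (elim dvdE)
  show "4 dvd p ^ m - 1" "p - 1 dvd (p ^ m - 1) div 4" using ps k by simp_all
  have s_cong: "[s = m] (mod d)" if "[p = 1] (mod d)" for d
  proof -
    have "[p ^ i = 1] (mod d)" for i using cong_pow[OF that, of i] by simp
    hence "[s = (\<Sum>i<m. 1)] (mod d)" unfolding s_def by (intro cong_sum)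
    thus ?thesis by simp
  qed
  show op: "odd p"
  proof
    assume "even p"
    hence "even (p ^ m)" using assms(3) by simp
    moreover have "p ^ m > 0" using p1 by simp
    moreover have "even (p ^ m - 1)" using ps k by simp
    ultimately show False by simp
  qed
  have "[s = m] (mod 2)" using op by (intro s_cong) (simp add: cong_def odd_iff_mod_2_eq_one)
  thus "even m" using k cong_dvd_iff[of s m 2] by simp
  show "4 dvd m" if "p mod 4 = 1"
  proof -
    have "[s = m] (mod 4)" using that by (intro s_cong) (simp add: cong_def)
    thus ?thesis using s4 by (simp add: cong_dvd_iff)
  qed
qed

text \<open>Keeping eigenvalues that differ in the sign of \<open>y\<close> together makes the signs
  of \<open>c\<close> and \<open>d\<close> immaterial.\<close>

definition eigenvalue_pair :: "nat \<Rightarrow> real \<Rightarrow> real \<Rightarrow> complex multiset" where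
  "eigenvalue_pair n x y =
    replicate_mset n (complex_of_real ((x + y - 1) / 4)) + replicate_mset n (complex_of_real ((x - y - 1) / 4))"

lemma eigenvalue_pair_minus: "eigenvalue_pair n x (- y) = eigenvalue_pair n x y"
  by (simp add: eigenvalue_pair_def add.commute)

context quartic_field
begin

text \<open>Of the two quotients \<open>a\<close> and \<open>b\<close>, the even one is
  \<open>2 * d\<close> and the odd one is \<open>c\<close>; the sign of the quadratic Gauss sum
  \<open>G\<close> is tied to which is which.\<close>

lemma spectrum_split_case:
  assumes p4: "p mod 4 = 1" and "odd p" and t: "t > 0" and card: "CARD('a) = p ^ (4 * t)"
  obtains c d :: int where "c\<^sup>2 + 4 * d\<^sup>2 = int p ^ (2 * t)" "odd c" "\<not> int p dvd c"
    "spectrum_mset (gamma4_adj :: complex ^ 'a::{finite,field} ^ 'a::{finite,field}) =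
      {#of_nat n#} + eigenvalue_pair n (real p ^ (2 * t)) (4 * real_of_int d * real p ^ t)
        + eigenvalue_pair n (- (real p ^ (2 * t))) (2 * real_of_int c * real p ^ t)"
proof -
  obtain h\<^sub>0 h\<^sub>1 h\<^sub>2 h\<^sub>3 U V where
    h: "\<eta> 1 = of_int h\<^sub>0" "\<eta> g = of_int h\<^sub>1" "\<eta> (g ^ 2) = of_int h\<^sub>2" "\<eta> (g ^ 3) = of_int h\<^sub>3" and
    rel: "h\<^sub>0 + h\<^sub>1 + h\<^sub>2 + h\<^sub>3 = - 1" "(h\<^sub>0 - h\<^sub>2)\<^sup>2 + (h\<^sub>1 - h\<^sub>3)\<^sup>2 = int CARD('a)"
    "(h\<^sub>0 - h\<^sub>1 + h\<^sub>2 - h\<^sub>3)\<^sup>2 = int CARD('a)"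
    "(h\<^sub>0 - h\<^sub>2)\<^sup>2 - (h\<^sub>1 - h\<^sub>3)\<^sup>2 = (h\<^sub>0 - h\<^sub>1 + h\<^sub>2 - h\<^sub>3) * U"
    "2 * (h\<^sub>0 - h\<^sub>2) * (h\<^sub>1 - h\<^sub>3) = (h\<^sub>0 - h\<^sub>1 + h\<^sub>2 - h\<^sub>3) * V" and
    UV: "U = (\<Sum>x\<in>UNIV. re\<^sub>4 (x * (1 - x)))" "V = (\<Sum>x\<in>UNIV. im\<^sub>4 (x * (1 - x)))"
    by (rule eta_relations)
  have card4: "int CARD('a) = int p ^ (4 * t)" using card by simp
  define P where "P = int p ^ t"
  have P2: "int p ^ (2 * t) = P\<^sup>2" by (simp add: P_def power_mult mult.commute)
  have rP: "real_of_int P = real p ^ t" by (simp add: P_def)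
  have rP2: "real p ^ (2 * t) = (real_of_int P)\<^sup>2" unfolding rP by (simp add: power_mult mult.commute)
  obtain a b where ab: "h\<^sub>0 - h\<^sub>2 = int p ^ t * a" "h\<^sub>1 - h\<^sub>3 = int p ^ t * b" "a\<^sup>2 + b\<^sup>2 = int p ^ (2 * t)"
    "\<not> int p dvd a" "\<not> int p dvd b"
    by (rule exact_power_dvd_of_square[OF p \<open>odd p\<close> t rel(2,3)[unfolded card4] rel(4,5)])
       (use jacobi_sum_not_dvd[OF p4 card] UV in auto)
  define G where "G = h\<^sub>0 - h\<^sub>1 + h\<^sub>2 - h\<^sub>3"
  \<comment> \<open>The periods are recovered from their sum, from \<open>G\<close> and from the two
    differences.\<close>
  have hs: "4 * h\<^sub>0 = G + 2 * (P * a) - 1" "4 * h\<^sub>2 = G - 2 * (P * a) - 1"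
    "4 * h\<^sub>1 = - G + 2 * (P * b) - 1" "4 * h\<^sub>3 = - G - 2 * (P * b) - 1"
    using rel(1) ab(1,2) unfolding G_def P_def by linarith+
  have par: "G = P\<^sup>2 \<and> even a \<and> odd b \<or> G = - (P\<^sup>2) \<and> odd a \<and> even b"
  proof (rule quartic_period_parity)
    show "odd P" using \<open>odd p\<close> by (simp add: P_def)
    show "a\<^sup>2 + b\<^sup>2 = P\<^sup>2" using ab(3) P2 by simp
    show "G\<^sup>2 = (P\<^sup>2)\<^sup>2" using rel(3) card4 by (simp add: G_def P_def flip: power_mult)
    show "4 dvd G + 2 * (P * a) - 1" unfolding hs(1)[symmetric] by simp
  qed
  have hr: "real_of_int h\<^sub>0 = (real_of_int G + 2 * (real_of_int P * a) - 1) / 4"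
    "real_of_int h\<^sub>2 = (real_of_int G - 2 * (real_of_int P * a) - 1) / 4"
    "real_of_int h\<^sub>1 = (- real_of_int G + 2 * (real_of_int P * b) - 1) / 4"
    "real_of_int h\<^sub>3 = (- real_of_int G - 2 * (real_of_int P * b) - 1) / 4"
    using hs[THEN arg_cong[of _ _ real_of_int]] by simp_all
  have eta_real: "\<eta> 1 = complex_of_real (real_of_int h\<^sub>0)" "\<eta> g = complex_of_real (real_of_int h\<^sub>1)"
    "\<eta> (g ^ 2) = complex_of_real (real_of_int h\<^sub>2)" "\<eta> (g ^ 3) = complex_of_real (real_of_int h\<^sub>3)"
    using h by simp_all
  have spec: "spectrum_mset (gamma4_adj :: complex ^ 'a::{finite,field} ^ 'a::{finite,field})
      = {#of_nat n#} + eigenvalue_pair n (real_of_int G) (2 * (real_of_int P * real_of_int a))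
        + eigenvalue_pair n (- real_of_int G) (2 * (real_of_int P * real_of_int b))"
    unfolding spectrum_gamma4 eigenvalue_pair_def eta_real hr by (simp only: add_ac)
  from par show thesis
  proof
    assume H: "G = P\<^sup>2 \<and> even a \<and> odd b"
    then obtain d where d: "a = 2 * d" by (elim conjE evenE)
    have "real_of_int G = real p ^ (2 * t)" "2 * (real_of_int P * real_of_int a) = 4 * real_of_int d * real p ^ t"
      "2 * (real_of_int P * real_of_int b) = 2 * real_of_int b * real p ^ t"
      using H rP2 by (simp_all add: d rP)
    hence "spectrum_mset (gamma4_adj :: complex ^ 'a::{finite,field} ^ 'a::{finite,field}) =
      {#of_nat n#} + eigenvalue_pair n (real p ^ (2 * t)) (4 * real_of_int d * real p ^ t)
        + eigenvalue_pair n (- (real p ^ (2 * t))) (2 * real_of_int b * real p ^ t)"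
      unfolding spec by (simp only: add_ac minus_minus)
    thus thesis by (rule that[rotated 3]) (use H ab d in \<open>auto simp: power_mult_distrib add_ac\<close>)
  next
    \<comment> \<open>With the opposite sign of \<open>G\<close> the roles of \<open>a\<close> and
      \<open>b\<close>, and with them the two pairs of eigenvalues, are exchanged.\<close>
    assume H: "G = - (P\<^sup>2) \<and> odd a \<and> even b"
    then obtain d where d: "b = 2 * d" by (elim conjE evenE)
    have "real_of_int G = - (real p ^ (2 * t))" "2 * (real_of_int P * real_of_int b) = 4 * real_of_int d * real p ^ t"
      "2 * (real_of_int P * real_of_int a) = 2 * real_of_int a * real p ^ t"
      using H rP2 by (simp_all add: d rP)
    hence "spectrum_mset (gamma4_adj :: complex ^ 'a::{finite,field} ^ 'a::{finite,field}) =
      {#of_nat n#} + eigenvalue_pair n (real p ^ (2 * t)) (4 * real_of_int d * real p ^ t)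
        + eigenvalue_pair n (- (real p ^ (2 * t))) (2 * real_of_int a * real p ^ t)"
      unfolding spec by (simp only: add_ac minus_minus)
    thus thesis by (rule that[rotated 3]) (use H ab d in \<open>auto simp: power_mult_distrib add_ac\<close>)
  qed
qed

text \<open>Inertness of \<open>p\<close> makes one coordinate of the quartic Gauss sum vanish, so
  the periods take at most two values, which also yields strong regularity. The congruence modulo 4
  is kept to fix the sign of \<open>D\<close> later.\<close>

lemma spectrum_semiprimitive_case:
  assumes p4: "p mod 4 = 3" and card: "CARD('a) = p ^ (2 * s)"
  obtains D :: int where "D = int p ^ s \<or> D = - (int p ^ s)" "4 dvd D - 1"
    "spectrum_mset (gamma4_adj :: complex ^ 'a::{finite,field} ^ 'a::{finite,field}) =
      {#of_nat n#} + replicate_mset (3 * n) (complex_of_real ((real_of_int D - 1) / 4))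
        + replicate_mset n (complex_of_real ((- 3 * real_of_int D - 1) / 4))"
    "strongly_regular (gamma4_edge :: 'a::{finite,field} \<Rightarrow> 'a::{finite,field} \<Rightarrow> bool)"
proof -
  obtain h\<^sub>0 h\<^sub>1 h\<^sub>2 h\<^sub>3 where
    h: "\<eta> 1 = of_int h\<^sub>0" "\<eta> g = of_int h\<^sub>1" "\<eta> (g ^ 2) = of_int h\<^sub>2" "\<eta> (g ^ 3) = of_int h\<^sub>3" and
    rel: "h\<^sub>0 + h\<^sub>1 + h\<^sub>2 + h\<^sub>3 = - 1" "(h\<^sub>0 - h\<^sub>2)\<^sup>2 + (h\<^sub>1 - h\<^sub>3)\<^sup>2 = int CARD('a)"
    "(h\<^sub>0 - h\<^sub>1 + h\<^sub>2 - h\<^sub>3)\<^sup>2 = int CARD('a)"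
    by (rule eta_relations)
  have card2: "int CARD('a) = int p ^ (2 * s)" "int CARD('a) = (int p ^ s)\<^sup>2"
    using card by (simp_all add: power_mult mult.commute)
  have zero: "h\<^sub>0 - h\<^sub>2 = 0 \<or> h\<^sub>1 - h\<^sub>3 = 0"
    using sum_squares_eq_inert_prime_power[OF p p4 rel(2)[unfolded card2(1)]] .
  obtain D where D: "D = int p ^ s \<or> D = - (int p ^ s)" "4 dvd D - 1" and
    hs: "4 * h\<^sub>0 + 1 = - 3 * D \<and> 4 * h\<^sub>1 + 1 = D \<and> 4 * h\<^sub>2 + 1 = D \<and> 4 * h\<^sub>3 + 1 = D \<or>
     4 * h\<^sub>0 + 1 = D \<and> 4 * h\<^sub>1 + 1 = - 3 * D \<and> 4 * h\<^sub>2 + 1 = D \<and> 4 * h\<^sub>3 + 1 = D \<or>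
     4 * h\<^sub>0 + 1 = D \<and> 4 * h\<^sub>1 + 1 = D \<and> 4 * h\<^sub>2 + 1 = - 3 * D \<and> 4 * h\<^sub>3 + 1 = D \<or>
     4 * h\<^sub>0 + 1 = D \<and> 4 * h\<^sub>1 + 1 = D \<and> 4 * h\<^sub>2 + 1 = D \<and> 4 * h\<^sub>3 + 1 = - 3 * D"
    using semiprimitive_periods[OF rel(1) rel(2,3)[unfolded card2(2)] zero] .
  define \<alpha> \<beta> where ab: "\<alpha> = complex_of_real ((real_of_int D - 1) / 4)"
    "\<beta> = complex_of_real ((- 3 * real_of_int D - 1) / 4)"
  have "of_int x = complex_of_real (real_of_int x)" for x by simp
  moreover have "real_of_int x = (real_of_int D - 1) / 4" if "4 * x + 1 = D" for x
    using arg_cong[OF that, of real_of_int] by simp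
  moreover have "real_of_int x = (- 3 * real_of_int D - 1) / 4" if "4 * x + 1 = - 3 * D" for x
    using arg_cong[OF that, of real_of_int] by simp
  ultimately have h_ab: "4 * x + 1 = D \<Longrightarrow> of_int x = \<alpha>" "4 * x + 1 = - 3 * D \<Longrightarrow> of_int x = \<beta>" for x
    unfolding ab by metis+
  have rep3: "replicate_mset (3 * n) x = replicate_mset n x + replicate_mset n x + replicate_mset n x" for x :: complex
    by (rule multiset_eqI) simp
  show thesis
  proof (rule that[OF D])
    show "spectrum_mset (gamma4_adj :: complex ^ 'a::{finite,field} ^ 'a::{finite,field}) =
      {#of_nat n#} + replicate_mset (3 * n) (complex_of_real ((real_of_int D - 1) / 4))
        + replicate_mset n (complex_of_real ((- 3 * real_of_int D - 1) / 4))"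
      using hs unfolding spectrum_gamma4 h rep3 ab[symmetric]
      by (elim disjE conjE) (simp_all only: h_ab add_ac)
    show "strongly_regular (gamma4_edge :: 'a::{finite,field} \<Rightarrow> 'a::{finite,field} \<Rightarrow> bool)"
    proof (rule gamma4_strongly_regular)
      fix b :: 'a assume "b \<noteq> 0"
      thus "\<eta> b = \<alpha> \<or> \<eta> b = \<beta>" using eta_cases[of b] hs h_ab unfolding h by metis
    qed
  qed
qed

end

theorem theorem6p3:
  fixes p m q n :: nat
  assumes p: "prime p"
    and q: "CARD('a::{finite,field}) = q" and qpm: "q = p ^ m"
    and div4: "4 dvd ((q - 1) div (p - 1))"
    and q5: "q \<ge> 5" and q9: "q \<noteq> 9"
    and n: "n = (q - 1) div 4"
  shows
   "digraph_connected (gamma4_edge :: 'a::{finite,field} \<Rightarrow> 'a::{finite,field} \<Rightarrow> bool) \<and>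
    integral_spectrum (gamma4_adj :: complex ^ 'a::{finite,field} ^ 'a::{finite,field}) \<and>
    (p mod 4 = 1 \<longrightarrow>
       (\<exists>t. m = 4 * t) \<and>
       (\<exists>c d :: int. real_of_int (c^2 + 4 * d^2) = sqrt (real q) \<and> c mod 4 = 1 \<and> gcd c (int p) = 1) \<and>
       (\<forall>c d c' d' :: int.
          real_of_int (c^2 + 4 * d^2) = sqrt (real q) \<and> c mod 4 = 1 \<and> gcd c (int p) = 1 \<and>
          real_of_int (c'^2 + 4 * d'^2) = sqrt (real q) \<and> c' mod 4 = 1 \<and> gcd c' (int p) = 1
          \<longrightarrow> c = c' \<and> \<bar>d\<bar> = \<bar>d'\<bar>) \<and>
       (\<forall>c d :: int.
          real_of_int (c^2 + 4 * d^2) = sqrt (real q) \<and> c mod 4 = 1 \<and> gcd c (int p) = 1 \<longrightarrow>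
          spectrum_mset (gamma4_adj :: complex ^ 'a::{finite,field} ^ 'a::{finite,field}) =
            {# of_nat n #}
            + replicate_mset n (complex_of_real ((sqrt q + 4 * d * root 4 q - 1) / 4))
            + replicate_mset n (complex_of_real ((sqrt q - 4 * d * root 4 q - 1) / 4))
            + replicate_mset n (complex_of_real ((- sqrt q + 2 * c * root 4 q - 1) / 4))
            + replicate_mset n (complex_of_real ((- sqrt q - 2 * c * root 4 q - 1) / 4)))) \<and>
    (p mod 4 = 3 \<longrightarrow>
       (\<exists>t. m = 2 * t) \<and>
       (m mod 4 = 0 \<longrightarrow>
          spectrum_mset (gamma4_adj :: complex ^ 'a::{finite,field} ^ 'a::{finite,field}) =
            {# of_nat n #}
            + replicate_mset (3 * n) (complex_of_real ((sqrt q - 1) / 4))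
            + replicate_mset n (complex_of_real (- (3 * sqrt q + 1) / 4))) \<and>
       (m mod 4 = 2 \<longrightarrow>
          spectrum_mset (gamma4_adj :: complex ^ 'a::{finite,field} ^ 'a::{finite,field}) =
            {# of_nat n #}
            + replicate_mset n (complex_of_real ((3 * sqrt q - 1) / 4))
            + replicate_mset (3 * n) (complex_of_real ((- sqrt q - 1) / 4))) \<and>
       strongly_regular (gamma4_edge :: 'a::{finite,field} \<Rightarrow> 'a::{finite,field} \<Rightarrow> bool))"
proof -
  have pp: "prime (int p)" using p by simp
  have m_pos: "m > 0" using q5 qpm by (cases m) auto
  note geo = geometric_sum_mod_4[OF p div4[unfolded qpm] m_pos, folded qpm]
  have q4: "q = 4 * n + 1" using geo(2) q5 unfolding n by auto
  obtain s where s: "m = 2 * s" using geo(4) by (elim evenE)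
  have qr: "q = (p ^ s)\<^sup>2" by (simp add: qpm s power_mult mult.commute)
  \<comment> \<open>\<open>q\<close> is the square of an odd number \<open>2 * k + 1\<close>, so
    \<open>n = k * (k + 1)\<close>.\<close>
  have even_n: "even n"
  proof -
    obtain k where "p ^ s = 2 * k + 1" using geo(3) by (metis even_power oddE)
    hence "4 * n + 1 = 4 * (k * (k + 1)) + 1" using q4 qr by (simp add: power2_eq_square algebra_simps)
    hence "n = k * (k + 1)" by simp
    thus ?thesis by simp
  qed
  \<comment> \<open>Parity excludes \<open>n = 1\<close>, \<open>q \<ge> 5\<close> excludes
    \<open>n = 0\<close>, and \<open>n = 2\<close> is exactly the exceptional
    \<open>q = 9\<close>.\<close>
  have n2: "n > 2" using even_n q4 q5 q9 by (cases "n = 0 \<or> n = 1 \<or> n = 2") auto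
  obtain \<psi> :: "'a \<Rightarrow> complex" where psi: "additive_character \<psi>"
    using additive_character_exists[OF p, where ?'a = 'a] q qpm by metis
  \<comment> \<open>The exponent \<open>2 * n\<close> is half of \<open>q - 1\<close>. The chosen
    power squares to 1 without being 1, hence it is \<open>- 1\<close>.\<close>
  obtain g :: 'a where g0: "g \<noteq> 0" "g ^ (2 * n) \<noteq> 1"
    using exists_power_neq_1[of "2 * n", where ?'a = 'a] q q4 n2 by auto
  have g: "(g ^ n)\<^sup>2 = - 1"
  proof -
    have "g ^ (4 * n) = 1" using power_CARD_minus_1[OF g0(1)] q q4 by simp
    moreover have "g ^ (4 * n) = g ^ (2 * n) * g ^ (2 * n)" by (simp flip: power_add)
    ultimately have "g ^ (2 * n) = - 1" using g0(2) square_eq_1_iff by metis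
    thus ?thesis by (simp add: mult.commute flip: power_mult)
  qed
  interpret additive_character \<psi> by (rule psi)
  interpret quartic_field \<psi> p n g
  proof
    show "CHAR('a) = p" using CHAR_eq_of_CARD_eq_prime_power[OF p, where ?'a = 'a] q qpm by simp
    show "p - 1 dvd n" using geo(1) n by simp
  qed (use p q q4 n2 even_n g in auto)
  have sqrt_q: "sqrt (real q) = real p ^ s" by (simp add: qr)
  show ?thesis
  proof (intro conjI impI)
    show "digraph_connected (gamma4_edge :: 'a::{finite,field} \<Rightarrow> 'a::{finite,field} \<Rightarrow> bool)"
      by (rule gamma4_connected[OF n2])
    have "\<eta> b \<in> \<int>" for b using eta_eq_of_int[of b] by auto
    thus "integral_spectrum (gamma4_adj :: complex ^ 'a::{finite,field} ^ 'a::{finite,field})"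
      unfolding integral_spectrum_def spectrum_gamma4 by (auto split: if_splits)
  next
    assume p4: "p mod 4 = 1"
    obtain t where t: "m = 4 * t" using geo(5)[OF p4] by (elim dvdE)
    show "\<exists>t. m = 4 * t" using t by blast
    have t_pos: "t > 0" using m_pos t by simp
    have s_t: "s = 2 * t" using s t by simp
    have rt: "root 4 (real q) = real p ^ t"
    proof -
      have "real q = (real p ^ t) ^ 4" using qpm t by (simp add: power_mult mult.commute)
      thus ?thesis by (simp add: real_root_power_cancel)
    qed
    have cop: "gcd c (int p) = 1 \<longleftrightarrow> \<not> int p dvd c" for c
      using pp by (metis coprime_iff_gcd_eq_1 coprime_commute prime_imp_coprime coprime_absorb_left not_prime_unit)
    have sum_iff: "real_of_int (c\<^sup>2 + 4 * d\<^sup>2) = sqrt (real q) \<longleftrightarrow> c\<^sup>2 + 4 * d\<^sup>2 = int p ^ (2 * t)" for c d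
      unfolding sqrt_q s_t by (metis of_int_eq_iff of_int_power of_int_of_nat_eq)
    note unique = sum_two_squares_prime_power_unique[OF p geo(3), where k = "2 * t"]
    have card: "CARD('a) = p ^ (4 * t)" using q qpm t by simp
    obtain c\<^sub>0 d\<^sub>0 where cd0: "c\<^sub>0\<^sup>2 + 4 * d\<^sub>0\<^sup>2 = int p ^ (2 * t)" "odd c\<^sub>0" "\<not> int p dvd c\<^sub>0"
      and spec0: "spectrum_mset (gamma4_adj :: complex ^ 'a::{finite,field} ^ 'a::{finite,field}) =
        {#of_nat n#} + eigenvalue_pair n (real p ^ (2 * t)) (4 * real_of_int d\<^sub>0 * real p ^ t)
          + eigenvalue_pair n (- (real p ^ (2 * t))) (2 * real_of_int c\<^sub>0 * real p ^ t)"
      by (rule spectrum_split_case[OF p4 geo(3) t_pos card])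
    \<comment> \<open>An odd integer or its negative is 1 modulo 4, so the normalisation only fixes
      the sign of \<open>c\<^sub>0\<close>.\<close>
    have "c\<^sub>0 mod 4 = 1 \<or> (- c\<^sub>0) mod 4 = 1" using cd0(2) by presburger
    thus "\<exists>c d :: int. real_of_int (c\<^sup>2 + 4 * d\<^sup>2) = sqrt (real q) \<and> c mod 4 = 1 \<and> gcd c (int p) = 1"
      unfolding sum_iff cop
    proof
      assume "c\<^sub>0 mod 4 = 1"
      thus "\<exists>c d. c\<^sup>2 + 4 * d\<^sup>2 = int p ^ (2 * t) \<and> c mod 4 = 1 \<and> \<not> int p dvd c" using cd0 by blast
    next
      assume "(- c\<^sub>0) mod 4 = 1"
      thus "\<exists>c d. c\<^sup>2 + 4 * d\<^sup>2 = int p ^ (2 * t) \<and> c mod 4 = 1 \<and> \<not> int p dvd c"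
        using cd0 by (intro exI[of _ "- c\<^sub>0"] exI[of _ d\<^sub>0]) simp
    qed
    show "\<forall>c d c' d' :: int.
          real_of_int (c^2 + 4 * d^2) = sqrt (real q) \<and> c mod 4 = 1 \<and> gcd c (int p) = 1 \<and>
          real_of_int (c'^2 + 4 * d'^2) = sqrt (real q) \<and> c' mod 4 = 1 \<and> gcd c' (int p) = 1
          \<longrightarrow> c = c' \<and> \<bar>d\<bar> = \<bar>d'\<bar>"
      unfolding sum_iff cop
    proof (intro allI impI, elim conjE)
      fix c d c' d' :: int
      assume H: "c\<^sup>2 + 4 * d\<^sup>2 = int p ^ (2 * t)" "\<not> int p dvd c" "c'\<^sup>2 + 4 * d'\<^sup>2 = int p ^ (2 * t)" "\<not> int p dvd c'"
        and c: "c mod 4 = 1" "c' mod 4 = 1"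
      have "c = c' \<or> c = - c'" using unique[OF H] power2_eq_iff by blast
      moreover have "c \<noteq> - c'" using c by presburger
      ultimately show "c = c' \<and> \<bar>d\<bar> = \<bar>d'\<bar>" using unique[OF H] by (simp add: abs_eq_iff power2_eq_iff)
    qed
    show "\<forall>c d :: int.
          real_of_int (c^2 + 4 * d^2) = sqrt (real q) \<and> c mod 4 = 1 \<and> gcd c (int p) = 1 \<longrightarrow>
          spectrum_mset (gamma4_adj :: complex ^ 'a::{finite,field} ^ 'a::{finite,field}) =
            {# of_nat n #}
            + replicate_mset n (complex_of_real ((sqrt q + 4 * d * root 4 q - 1) / 4))
            + replicate_mset n (complex_of_real ((sqrt q - 4 * d * root 4 q - 1) / 4))
            + replicate_mset n (complex_of_real ((- sqrt q + 2 * c * root 4 q - 1) / 4))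
            + replicate_mset n (complex_of_real ((- sqrt q - 2 * c * root 4 q - 1) / 4))"
      unfolding sum_iff cop
    proof (intro allI impI, elim conjE)
      fix c d :: int
      assume H: "c\<^sup>2 + 4 * d\<^sup>2 = int p ^ (2 * t)" "\<not> int p dvd c"
      have "c = c\<^sub>0 \<or> c = - c\<^sub>0" "d = d\<^sub>0 \<or> d = - d\<^sub>0"
        using unique[OF H cd0(1,3)] power2_eq_iff by blast+
      hence eq: "eigenvalue_pair n x (2 * real_of_int c\<^sub>0 * y) = eigenvalue_pair n x (2 * real_of_int c * y)"
        "eigenvalue_pair n x (4 * real_of_int d\<^sub>0 * y) = eigenvalue_pair n x (4 * real_of_int d * y)" for x y
        using eigenvalue_pair_minus[of n x "2 * real_of_int c\<^sub>0 * y"] eigenvalue_pair_minus[of n x "4 * real_of_int d\<^sub>0 * y"]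
        by auto
      show "spectrum_mset (gamma4_adj :: complex ^ 'a::{finite,field} ^ 'a::{finite,field}) =
            {# of_nat n #}
            + replicate_mset n (complex_of_real ((sqrt q + real_of_int (4 * d) * root 4 q - 1) / 4))
            + replicate_mset n (complex_of_real ((sqrt q - real_of_int (4 * d) * root 4 q - 1) / 4))
            + replicate_mset n (complex_of_real ((- sqrt q + 2 * real_of_int c * root 4 q - 1) / 4))
            + replicate_mset n (complex_of_real ((- sqrt q - 2 * real_of_int c * root 4 q - 1) / 4))"
        unfolding spec0 eq unfolding sqrt_q s_t rt eigenvalue_pair_def
        by (simp only: add.assoc of_int_mult of_int_numeral)
    qed
  next
    assume p4: "p mod 4 = 3"
    have card: "CARD('a) = p ^ (2 * s)" using q qpm s by simp
    obtain D where D: "D = int p ^ s \<or> D = - (int p ^ s)" "4 dvd D - 1"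
      and spec: "spectrum_mset (gamma4_adj :: complex ^ 'a::{finite,field} ^ 'a::{finite,field}) =
        {#of_nat n#} + replicate_mset (3 * n) (complex_of_real ((real_of_int D - 1) / 4))
          + replicate_mset n (complex_of_real ((- 3 * real_of_int D - 1) / 4))"
      and srg: "strongly_regular (gamma4_edge :: 'a::{finite,field} \<Rightarrow> 'a::{finite,field} \<Rightarrow> bool)"
      by (rule spectrum_semiprimitive_case[OF p4 card])
    show "\<exists>t. m = 2 * t" using s by blast
    show "strongly_regular (gamma4_edge :: 'a::{finite,field} \<Rightarrow> 'a::{finite,field} \<Rightarrow> bool)" by (rule srg)
    \<comment> \<open>Since \<open>D\<close> is 1 modulo 4, its sign is \<open>(- 1) ^ s\<close>,
      and \<open>m = 2 * s\<close> modulo 4 reveals the parity of \<open>s\<close>.\<close>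
    have r_mod: "[int p ^ s = (- 1) ^ s] (mod 4)"
    proof (rule cong_pow)
      have "int p mod 4 = 3" using p4 by presburger
      thus "[int p = - 1] (mod 4)" by (simp add: cong_def)
    qed
    {
      assume "m mod 4 = 0"
      hence "even s" using s by presburger
      hence "int p ^ s mod 4 = 1" using r_mod by (simp add: cong_def)
      hence "D = int p ^ s" using D by presburger
      thus "spectrum_mset (gamma4_adj :: complex ^ 'a::{finite,field} ^ 'a::{finite,field}) =
            {# of_nat n #}
            + replicate_mset (3 * n) (complex_of_real ((sqrt q - 1) / 4))
            + replicate_mset n (complex_of_real (- (3 * sqrt q + 1) / 4))"
        unfolding spec sqrt_q by simp
    }
    {
      assume "m mod 4 = 2"
      hence "odd s" using s by presburger
      hence "int p ^ s mod 4 = 3" using r_mod by (simp add: cong_def)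
      hence "D = - (int p ^ s)" using D by presburger
      thus "spectrum_mset (gamma4_adj :: complex ^ 'a::{finite,field} ^ 'a::{finite,field}) =
            {# of_nat n #}
            + replicate_mset n (complex_of_real ((3 * sqrt q - 1) / 4))
            + replicate_mset (3 * n) (complex_of_real ((- sqrt q - 1) / 4))"
        unfolding spec sqrt_q by (simp add: add_ac)
    }
  qed
qed

end
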